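(* Consider the planar Stark problem $$\ddot x=-\frac{x}{r^3}+1,\qquad \ddot y=-\frac{y}{r^3},\qquad r=\sqrt{x^2+y^2}.$$ For any $a'\in(-1,1)$ there exist $k_b\in\mathbb N$ and real numbers $\{d_k\}_{k\ge k_b}$, $\{d'_k\}_{k\ge k_b}$ such that, letting $A'_k$ and $B'_k$ denote the solutions with zero initial velocity $(\dot x(0),\dot y(0))=(0,0)$ and initial positions $(x(0),y(0))=(a',d_k)$ and $(a',d'_k)$ respectively, the following hold: (i) $A'_k$ is a brake orbit which intersects the positive $x$-axis $k$ times and then intersects the negative $x$-axis perpendicularly; (ii) $B'_k$ is a collision orbit which intersects the positive $x$-axis $k$ times before collision with the origin; (iii) $\lim_{k\to+\infty}d_k=\lim_{k\to+\infty}d'_k=\sqrt{1-a'^2}$, and $\lim_{a'\to1}k_b=+\infty$, where $k_b=k_b(a')$ is taken as small as possible; (iv) $d_k<d'_k$ and $d'_k<d_{k+1}$ for all $k\ge k_b$.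
   Context: A brake orbit is a periodic orbit such that $\dot q=0$ at some time. A collision orbit is a solution reaching the origin in finite time. The positive (resp. negative) $x$-axis is $\{(x,0):x>0\}$ (resp. $\{(x,0):x<0\}$). *)

theory Defs
  imports "HOL-Analysis.Analysis"
begin

definition stark_sol ::
  "(real \<Rightarrow> real) \<Rightarrow> (real \<Rightarrow> real) \<Rightarrow> (real \<Rightarrow> real) \<Rightarrow> (real \<Rightarrow> real) \<Rightarrow> real set \<Rightarrow> bool" where
  "stark_sol x y u v I \<longleftrightarrow>
     (\<forall>t\<in>I. (x t, y t) \<noteq> (0, 0) \<and>
        (x has_real_derivative u t) (at t within I) \<and>
        (y has_real_derivative v t) (at t within I) \<and>
        (u has_real_derivative (- x t / (sqrt (x t ^ 2 + y t ^ 2)) ^ 3 + 1)) (at t within I) \<and>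
        (v has_real_derivative (- y t / (sqrt (x t ^ 2 + y t ^ 2)) ^ 3)) (at t within I))"

definition pos_axis_times :: "(real \<Rightarrow> real) \<Rightarrow> (real \<Rightarrow> real) \<Rightarrow> real \<Rightarrow> real set" where
  "pos_axis_times x y T = {t \<in> {0<..<T}. y t = 0 \<and> x t > 0}"

definition brake_orbit_k :: "real \<Rightarrow> real \<Rightarrow> nat \<Rightarrow> bool" where
  "brake_orbit_k a d k \<longleftrightarrow>
     (\<exists>x y u v. stark_sol x y u v UNIV \<and>
        x 0 = a \<and> y 0 = d \<and> u 0 = 0 \<and> v 0 = 0 \<and>
        (\<exists>P>0. \<forall>t. x (t + P) = x t \<and> y (t + P) = y t \<and> u (t + P) = u t \<and> v (t + P) = v t) \<and>
        (\<exists>T>0. y T = 0 \<and> x T < 0 \<and> u T = 0 \<and>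
           finite (pos_axis_times x y T) \<and> card (pos_axis_times x y T) = k \<and>
           (\<forall>t\<in>{0<..<T}. \<not> (y t = 0 \<and> x t < 0))))"

definition collision_orbit_k :: "real \<Rightarrow> real \<Rightarrow> nat \<Rightarrow> bool" where
  "collision_orbit_k a d k \<longleftrightarrow>
     (\<exists>T>0. \<exists>x y u v. stark_sol x y u v {0..<T} \<and>
        x 0 = a \<and> y 0 = d \<and> u 0 = 0 \<and> v 0 = 0 \<and>
        ((\<lambda>t. (x t, y t)) \<longlongrightarrow> (0, 0)) (at_left T) \<and>
        finite (pos_axis_times x y T) \<and> card (pos_axis_times x y T) = k)"

definition stark_family :: "real \<Rightarrow> nat \<Rightarrow> (nat \<Rightarrow> real) \<Rightarrow> (nat \<Rightarrow> real) \<Rightarrow> bool" where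
  "stark_family a kb d d' \<longleftrightarrow>
     (\<forall>k\<ge>kb. brake_orbit_k a (d k) k \<and> collision_orbit_k a (d' k) k \<and>
              d k < d' k \<and> d' k < d (Suc k)) \<and>
     d \<longlonglongrightarrow> sqrt (1 - a ^ 2) \<and> d' \<longlonglongrightarrow> sqrt (1 - a ^ 2)"

definition kb_min :: "real \<Rightarrow> nat" where
  "kb_min a = (LEAST kb. \<exists>d d'. stark_family a kb d d')"

end

theory Submission
  imports Defs "HOL-Complex_Analysis.Conformal_Mappings"
begin

text \<open>
  In parabolic coordinates \<open>x = (X\<^sup>2 - Y\<^sup>2) / 2\<close>, \<open>y = X Y\<close> and the fictitious time
  \<open>\<tau>\<close> with \<open>dt = (X\<^sup>2 + Y\<^sup>2) d\<tau>\<close> the Stark problem separates.  Write \<open>r\<close> for the initial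
  distance to the origin.  For \<open>r < 1\<close>, zero initial velocity makes \<open>X\<close> and \<open>Y\<close> two independent
  anharmonic oscillators released from rest, with quarter periods \<open>K\<close> and \<open>L\<close>.
  The positive (negative) \<open>x\<close>-axis is \<open>Y = 0\<close> (\<open>X = 0\<close>), so \<open>K = 2 k L\<close> yields the brake orbit
  and \<open>K = (2 k + 1) L\<close> the collision orbit with \<open>k\<close> crossings.
  As \<open>r\<close> tends to 1 the oscillator \<open>X\<close> is released near an unstable equilibrium, so
  \<open>K / L\<close> tends to infinity and takes every large integer value.
  Conversely, no orbit with \<open>r \<ge> 1\<close> reaches the negative axis, and for \<open>a\<close> close to 1 every
  orbit with \<open>r < 1\<close> starts near the equilibrium, which forces many crossings and hence
  a large \<open>k\<^sub>b\<close>.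
\<close>

section \<open>Clocks and anharmonic oscillators\<close>

lemma continuous_antiderivative:
  fixes f :: "real \<Rightarrow> real"
  assumes "\<And>x. isCont f x"
  obtains F where "F 0 = 0" "\<And>x. (F has_real_derivative f x) (at x)"
proof -
  obtain G where G: "\<And>x. (G has_real_derivative f x) (at x)"
    using einterval_antiderivative[of "-\<infinity>" "\<infinity>" f] assms
    by (auto simp: has_real_derivative_iff_has_vector_derivative)
  show thesis
    by (rule that[of "\<lambda>x. G x - G 0"]) (auto intro!: derivative_eq_intros G)
qed

text \<open>A time change \<open>dt = f ds\<close> is inverted globally. Since \<open>F\<close>
  gains the same amount \<open>P\<close> over every period \<open>L\<close>, it is unbounded in both
  directions, so the strictly increasing \<open>F\<close> is a bijection of the line. This serves
  both for the pendulum angle and, with \<open>f = W\<close>, for the passage from fictitious to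
  physical time.\<close>

lemma periodic_clock:
  fixes f :: "real \<Rightarrow> real"
  assumes cont: "\<And>x. isCont f x" and pos: "\<And>x. f x > 0"
    and per: "\<And>x. f (x + L) = f x" and L: "L > 0"
  obtains F s P where "F 0 = 0" "\<And>x. (F has_real_derivative f x) (at x)"
    "strict_mono F" "\<And>x. s (F x) = x" "\<And>t. F (s t) = t"
    "\<And>t. (s has_real_derivative 1 / f (s t)) (at t)"
    "P > 0" "\<And>x. F (x + L) = F x + P" "\<And>t. s (t + P) = s t + L"
proof -
  obtain F where F0: "F 0 = 0" and F: "\<And>x. (F has_real_derivative f x) (at x)"
    using continuous_antiderivative[OF cont] by blast
  have mono: "strict_mono F"
    by (rule strict_monoI, rule DERIV_pos_imp_increasing) (use F pos in blast)+
  define P where "P = F L"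
  have P: "P > 0"
    using strict_monoD[OF mono L] F0 by (simp add: P_def)
  have FL: "F (x + L) = F x + P" for x
  proof -
    have "((\<lambda>x. F (x + L) - F x) has_real_derivative 0) (at z)" for z
      using F[of z] F[of "z + L"] per[of z]
      by (auto intro!: derivative_eq_intros DERIV_chain'[where g = F])
    then have "F (x + L) - F x = F (0 + L) - F 0"
      using DERIV_isconst_all[of "\<lambda>x. F (x + L) - F x"] by blast
    then show ?thesis by (simp add: P_def F0)
  qed
  have FnL: "F (x + real n * L) = F x + real n * P" for x n
  proof (induction n)
    case (Suc n)
    have "F (x + real (Suc n) * L) = F (x + real n * L + L)"
      by (simp add: algebra_simps)
    then show ?case using FL[of "x + real n * L"] Suc by (simp add: algebra_simps)
  qed simp
  have surj: "\<exists>x. F x = t" for t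
  proof -
    obtain n :: nat where n: "\<bar>t\<bar> < real n * P"
      using P reals_Archimedean3 by blast
    have "F (- (real n * L)) = - (real n * P)" "F (real n * L) = real n * P"
      using FnL[of "- (real n * L)" n] FnL[of 0 n] F0 by auto
    then have "\<exists>x\<ge>- (real n * L). x \<le> real n * L \<and> F x = t"
      using n L F by (intro IVT) (auto intro: DERIV_isCont)
    then show ?thesis by blast
  qed
  define s where "s = inv F"
  have sF: "s (F x) = x" for x
    unfolding s_def by (rule inv_f_f) (rule strict_mono_imp_inj_on[OF mono])
  have Fs: "F (s t) = t" for t
    unfolding s_def by (rule f_inv_into_f) (use surj in \<open>auto intro: rangeI simp: image_iff, metis\<close>)
  have ds: "(s has_real_derivative 1 / f (s t)) (at t)" for t
  proof -
    have "(s has_real_derivative inverse (f (s t))) (at (F (s t)))"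
      by (rule has_field_derivative_inverse_strong[where S = UNIV])
         (use F pos sF in \<open>auto intro!: DERIV_isCont continuous_at_imp_continuous_on simp: less_imp_neq[symmetric]\<close>)
    then show ?thesis by (simp add: Fs inverse_eq_divide)
  qed
  have "s (t + P) = s t + L" for t
    using FL[of "s t"] sF[of "s t + L"] Fs by simp
  with F0 F mono sF Fs ds P FL show thesis by (rule that)
qed

text \<open>A complete elliptic integral: for positive \<open>\<alpha>\<close> and
  \<open>\<alpha> + \<beta>\<close> it equals \<open>K(m) / sqrt (\<alpha> + \<beta>)\<close> with
  parameter \<open>m = \<beta> / (\<alpha> + \<beta>)\<close>. It is the time an angle with speed
  \<open>sqrt (\<alpha> + \<beta> * cos^2)\<close> needs for a quarter turn.\<close>

definition quarter_period :: "real \<Rightarrow> real \<Rightarrow> real" where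
  "quarter_period \<alpha> \<beta> = integral {0..pi/2} (\<lambda>s. 1 / sqrt (\<alpha> + \<beta> * (cos s)\<^sup>2))"

lemma clock_radicand_pos:
  fixes \<alpha> \<beta> :: real
  assumes "\<alpha> > 0" "\<alpha> + \<beta> > 0"
  shows "\<alpha> + \<beta> * (cos s)\<^sup>2 > 0"
proof -
  have "\<alpha> + \<beta> * (cos s)\<^sup>2 = \<alpha> * (sin s)\<^sup>2 + (\<alpha> + \<beta>) * (cos s)\<^sup>2"
    by (simp add: sin_squared_eq algebra_simps)
  moreover have "sin s \<noteq> 0 \<or> cos s \<noteq> 0"
    using sin_zero_abs_cos_one[of s] by auto
  ultimately show ?thesis
    using assms by (auto intro: add_pos_nonneg add_nonneg_pos)
qed

text \<open>The angle is the inverse of the incomplete elliptic integral \<open>F\<close>. A half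
  turn takes the time \<open>P\<close>, and symmetry splits it into two quarter turns of length
  \<open>K\<close>, which fixes the angle at all integer multiples of \<open>K\<close>.\<close>

lemma pendulum_clock:
  assumes \<alpha>: "\<alpha> > 0" and \<alpha>\<beta>: "\<alpha> + \<beta> > 0"
  defines "K \<equiv> quarter_period \<alpha> \<beta>"
  obtains \<theta> where "K > 0" 
    "\<And>\<tau>. (\<theta> has_real_derivative sqrt (\<alpha> + \<beta> * (cos (\<theta> \<tau>))\<^sup>2)) (at \<tau>)"
    "strict_mono \<theta>" "\<And>n::int. \<theta> (of_int n * K) = of_int n * (pi/2)"
    "\<And>\<tau>. \<theta> (\<tau> + 2 * K) = \<theta> \<tau> + pi"
proof -
  define f where "f = (\<lambda>s. 1 / sqrt (\<alpha> + \<beta> * (cos s)\<^sup>2))"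
  note pos = clock_radicand_pos[OF \<alpha> \<alpha>\<beta>]
  have fpos: "f s > 0" for s using pos[of s] by (simp add: f_def)
  have cont: "isCont f s" for s
    unfolding f_def using pos[of s] by (intro continuous_intros) auto
  have per: "f (s + pi) = f s" for s by (simp add: f_def)
  obtain F \<theta> P where F0: "F 0 = 0" and F: "\<And>x. (F has_real_derivative f x) (at x)"
    and mono: "strict_mono F" and tF: "\<And>x. \<theta> (F x) = x" and Ft: "\<And>t. F (\<theta> t) = t"
    and dt: "\<And>t. (\<theta> has_real_derivative 1 / f (\<theta> t)) (at t)"
    and P: "P > 0" "\<And>x. F (x + pi) = F x + P" "\<And>t. \<theta> (t + P) = \<theta> t + pi"
    using periodic_clock[of f pi, OF cont fpos per pi_gt_zero] by blast
  have "(f has_integral (F (pi/2) - F 0)) {0..pi/2}"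
    by (rule fundamental_theorem_of_calculus)
       (auto simp flip: has_real_derivative_iff_has_vector_derivative intro: DERIV_subset[OF F])
  then have FK: "F (pi/2) = K"
    unfolding K_def quarter_period_def using F0 by (simp add: f_def integral_unique)
  \<comment> \<open>the integrand is symmetric about \<open>pi/2\<close>\<close>
  have "((\<lambda>x. F x + F (pi - x)) has_real_derivative 0) (at z)" for z
    using F[of z] F[of "pi - z"]
    by (auto intro!: derivative_eq_intros DERIV_chain'[where g = F] simp: f_def)
  then have "F (pi/2) + F (pi - pi/2) = F 0 + F (pi - 0)"
    using DERIV_isconst_all[of "\<lambda>x. F x + F (pi - x)"] by blast
  then have P2: "P = 2 * K" using FK F0 P(2)[of 0] by simp
  have even: "\<theta> (x + of_int m * P) = \<theta> x + of_int m * pi" for x m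
  proof (induction m rule: int_induct[where k = 0])
    case (step1 i)
    then show ?case using P(3)[of "x + of_int i * P"] by (simp add: algebra_simps)
  next
    case (step2 i)
    have "\<theta> (x + of_int i * P) = \<theta> (x + of_int (i - 1) * P) + pi"
      using P(3)[of "x + of_int (i - 1) * P"] by (simp add: algebra_simps)
    then show ?case using step2 by (simp add: algebra_simps)
  qed simp
  have \<theta>K: "\<theta> K = pi/2" "\<theta> 0 = 0" using tF[of "pi/2"] tF[of 0] FK F0 by auto
  show thesis
  proof (rule that)
    show "K > 0" using P P2 by simp
    show "(\<theta> has_real_derivative sqrt (\<alpha> + \<beta> * (cos (\<theta> \<tau>))\<^sup>2)) (at \<tau>)" for \<tau>
      using dt[of \<tau>] by (simp add: f_def)
    show "strict_mono \<theta>"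
      by (rule strict_monoI) (metis Ft mono strict_mono_less)
    show "\<theta> (\<tau> + 2 * K) = \<theta> \<tau> + pi" for \<tau> using P(3) P2 by simp
    show "\<theta> (of_int n * K) = of_int n * (pi/2)" for n :: int
    proof (cases "even n")
      case True
      then obtain m where "n = 2 * m" by blast
      then show ?thesis using even[of 0 m] P2 \<theta>K by (simp add: algebra_simps)
    next
      case False
      then obtain m where "n = 2 * m + 1" by (rule oddE)
      then show ?thesis using even[of K m] P2 \<theta>K by (simp add: algebra_simps)
    qed
  qed
qed

text \<open>With \<open>z = cos \<theta>\<close> the clock becomes an oscillator of amplitude 1
  released from rest, a rescaled Jacobi function cn. Its zeros come from the odd multiples of
  \<open>pi/2\<close>, its turning points from the even ones. Both parabolic coordinates are scaled
  copies of such a \<open>z\<close>.\<close>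

lemma pendulum_oscillator:
  assumes \<alpha>: "\<alpha> > 0" and \<alpha>\<beta>: "\<alpha> + \<beta> > 0"
  defines "K \<equiv> quarter_period \<alpha> \<beta>"
  obtains z z' where "K > 0" "z 0 = 1" "z' 0 = 0"
    "\<And>\<tau>. (z has_real_derivative z' \<tau>) (at \<tau>)"
    "\<And>\<tau>. (z' has_real_derivative - (\<alpha> - \<beta>) * z \<tau> - 2 * \<beta> * z \<tau> ^ 3) (at \<tau>)"
    "\<And>\<tau>. (z' \<tau>)\<^sup>2 = (1 - (z \<tau>)\<^sup>2) * (\<alpha> + \<beta> * (z \<tau>)\<^sup>2)"
    "\<And>\<tau>. z \<tau> = 0 \<longleftrightarrow> (\<exists>n::int. odd n \<and> \<tau> = of_int n * K)"
    "\<And>\<tau>. \<bar>\<tau>\<bar> < K \<Longrightarrow> z \<tau> > 0"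
    "\<And>\<tau>. z (\<tau> + 4 * K) = z \<tau>" "\<And>\<tau>. z' (\<tau> + 4 * K) = z' \<tau>"
    "\<And>n::int. even n \<Longrightarrow> z' (of_int n * K) = 0"
proof -
  obtain \<theta> where K: "K > 0"
    and d: "\<And>\<tau>. (\<theta> has_real_derivative sqrt (\<alpha> + \<beta> * (cos (\<theta> \<tau>))\<^sup>2)) (at \<tau>)"
    and mono: "strict_mono \<theta>" and \<theta>n: "\<And>n::int. \<theta> (of_int n * K) = of_int n * (pi/2)"
    and per: "\<And>\<tau>. \<theta> (\<tau> + 2 * K) = \<theta> \<tau> + pi"
    using pendulum_clock[OF \<alpha> \<alpha>\<beta>] unfolding K_def by blast
  note pos = clock_radicand_pos[OF \<alpha> \<alpha>\<beta>]
  define z where "z = (\<lambda>\<tau>. cos (\<theta> \<tau>))"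
  define z' where "z' = (\<lambda>\<tau>. - sin (\<theta> \<tau>) * sqrt (\<alpha> + \<beta> * (cos (\<theta> \<tau>))\<^sup>2))"
  have per4: "\<theta> (\<tau> + 4 * K) = \<theta> \<tau> + 2 * pi" for \<tau>
    using per[of \<tau>] per[of "\<tau> + 2 * K"] by (simp add: algebra_simps)
  show thesis
  proof (rule that)
    show "K > 0" by fact
    show "z 0 = 1" "z' 0 = 0" using \<theta>n[of 0] by (auto simp: z_def z'_def)
    show "(z has_real_derivative z' \<tau>) (at \<tau>)" for \<tau>
      unfolding z_def z'_def by (rule derivative_eq_intros d refl)+
    show "(z' has_real_derivative - (\<alpha> - \<beta>) * z \<tau> - 2 * \<beta> * z \<tau> ^ 3) (at \<tau>)" for \<tau>
    proof -
      define g where "g = sqrt (\<alpha> + \<beta> * (cos (\<theta> \<tau>))\<^sup>2)"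
      have g: "g > 0" "g * g = \<alpha> + \<beta> * (cos (\<theta> \<tau>))\<^sup>2" using pos[of "\<theta> \<tau>"] by (auto simp: g_def)
      have dg: "((\<lambda>\<tau>. sqrt (\<alpha> + \<beta> * (cos (\<theta> \<tau>))\<^sup>2)) has_real_derivative - \<beta> * cos (\<theta> \<tau>) * sin (\<theta> \<tau>)) (at \<tau>)"
        using pos[of "\<theta> \<tau>"] by (auto intro!: derivative_eq_intros d)
      have "(z' has_real_derivative - (cos (\<theta> \<tau>) * g) * g + - sin (\<theta> \<tau>) * (- \<beta> * cos (\<theta> \<tau>) * sin (\<theta> \<tau>))) (at \<tau>)"
        unfolding z'_def by (rule derivative_eq_intros d dg refl)+ (simp add: g_def)
      moreover have "- (cos (\<theta> \<tau>) * g) * g + - sin (\<theta> \<tau>) * (- \<beta> * cos (\<theta> \<tau>) * sin (\<theta> \<tau>)) =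
        - (\<alpha> - \<beta>) * z \<tau> - 2 * \<beta> * z \<tau> ^ 3"
        unfolding z_def using g(2) sin_cos_squared_add[of "\<theta> \<tau>"] by algebra
      ultimately show ?thesis by simp
    qed
    show "(z' \<tau>)\<^sup>2 = (1 - (z \<tau>)\<^sup>2) * (\<alpha> + \<beta> * (z \<tau>)\<^sup>2)" for \<tau>
      using pos[of "\<theta> \<tau>"] by (simp add: z_def z'_def power_mult_distrib sin_squared_eq)
    show "z \<tau> = 0 \<longleftrightarrow> (\<exists>n::int. odd n \<and> \<tau> = of_int n * K)" for \<tau>
      unfolding z_def cos_zero_iff_int by (metis \<theta>n mono strict_mono_eq)
    show "z \<tau> > 0" if "\<bar>\<tau>\<bar> < K" for \<tau>
    proof -
      have "\<theta> (- K) < \<theta> \<tau>" "\<theta> \<tau> < \<theta> K" using that by (auto intro!: strict_monoD[OF mono])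
      then show ?thesis using \<theta>n[of 1] \<theta>n[of "-1"] by (auto simp: z_def intro!: cos_gt_zero_pi)
    qed
    show "z (\<tau> + 4 * K) = z \<tau>" "z' (\<tau> + 4 * K) = z' \<tau>" for \<tau>
      using per4[of \<tau>] by (auto simp: z_def z'_def)
    show "z' (of_int n * K) = 0" if "even n" for n :: int
      using that \<theta>n[of n] by (auto simp: z'_def sin_zero_iff_int2 elim!: evenE)
  qed
qed

section \<open>Uniqueness and conserved quantities of the Stark problem\<close>

text \<open>The product \<open>exp (- C * t) * w t\<close> is nonincreasing. Derivatives are taken
  within the closed interval and the inequality only in its interior, to fit solutions given on
  \<open>{0..T}\<close>.\<close>

lemma gronwall_nonpos:
  fixes w :: "real \<Rightarrow> real"
  assumes "a \<le> b"
    and dw: "\<And>t. t \<in> {a..b} \<Longrightarrow> (w has_real_derivative w' t) (at t within {a..b})"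
    and le: "\<And>t. a < t \<Longrightarrow> t < b \<Longrightarrow> w' t \<le> C * w t"
    and init: "w a \<le> 0"
  shows "w b \<le> 0"
proof -
  define g where "g = (\<lambda>t. exp (- C * t) * w t)"
  have dg: "(g has_real_derivative exp (- C * t) * (w' t - C * w t)) (at t within {a..b})"
    if "t \<in> {a..b}" for t
    unfolding g_def by (rule derivative_eq_intros dw that refl)+ (simp add: algebra_simps)
  have "g b \<le> g a"
  proof (rule DERIV_nonpos_imp_decreasing_open[OF \<open>a \<le> b\<close>])
    fix t assume t: "a < t" "t < b"
    then have "(g has_real_derivative exp (- C * t) * (w' t - C * w t)) (at t)"
      using dg[of t] by (simp add: at_within_Icc_at)
    moreover have "exp (- C * t) * (w' t - C * w t) \<le> 0"
      using le[of t] t by (simp add: mult_nonneg_nonpos)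
    ultimately show "\<exists>y. (g has_real_derivative y) (at t) \<and> y \<le> 0" by blast
  next
    show "continuous_on {a..b} g" using dg by (rule DERIV_continuous_on)
  qed
  also have "g a \<le> 0" using init by (simp add: g_def mult_nonneg_nonpos)
  finally show ?thesis by (simp add: g_def mult_le_0_iff)
qed

text \<open>Lipschitz estimate for one component of the attraction outside the disc of radius
  \<open>m\<close>; exchanging the roles of the coordinates gives the other component.\<close>

lemma inverse_cube_Lipschitz:
  fixes x1 y1 x2 y2 m :: real
  defines "r1 \<equiv> sqrt (x1\<^sup>2 + y1\<^sup>2)" and "r2 \<equiv> sqrt (x2\<^sup>2 + y2\<^sup>2)"
  assumes m: "m > 0" "m \<le> r1" "m \<le> r2"
  shows "\<bar>x1 / r1 ^ 3 - x2 / r2 ^ 3\<bar> \<le> 4 / m ^ 3 * (\<bar>x1 - x2\<bar> + \<bar>y1 - y2\<bar>)"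
proof -
  let ?D = "\<bar>x1 - x2\<bar> + \<bar>y1 - y2\<bar>"
  have r: "r1 > 0" "r2 > 0" using m by auto
  have "\<bar>r1 - r2\<bar> \<le> cmod (Complex x1 y1 - Complex x2 y2)"
    using norm_triangle_ineq3[of "Complex x1 y1" "Complex x2 y2"]
    by (simp add: r1_def r2_def cmod_def)
  also have "\<dots> \<le> ?D"
    using cmod_le[of "Complex x1 y1 - Complex x2 y2"] by simp
  finally have D: "\<bar>r1 - r2\<bar> \<le> ?D" .
  have x2: "\<bar>x2\<bar> \<le> r2" unfolding r2_def by (rule real_sqrt_ge_abs1)
  \<comment> \<open>Telescoping \<open>1 / r1 ^ 3 - 1 / r2 ^ 3\<close> produces the factor
    \<open>r2 - r1\<close> and three summands, each at most \<open>1 / m ^ 3\<close>. Together with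
    the first term they account for the constant 4.\<close>
  have "x1 / r1 ^ 3 - x2 / r2 ^ 3
      = (x1 - x2) / r1 ^ 3 + x2 / r2 * ((r2 - r1) * (1 / (r1 * r2\<^sup>2) + 1 / (r1\<^sup>2 * r2) + 1 / r1 ^ 3))"
    using r by (simp add: field_simps power2_eq_square power3_eq_cube)
  then have "\<bar>x1 / r1 ^ 3 - x2 / r2 ^ 3\<bar>
      \<le> \<bar>(x1 - x2) / r1 ^ 3\<bar> + \<bar>x2 / r2\<bar> * (\<bar>r2 - r1\<bar> * \<bar>1 / (r1 * r2\<^sup>2) + 1 / (r1\<^sup>2 * r2) + 1 / r1 ^ 3\<bar>)"
    by (metis abs_mult abs_triangle_ineq)
  also have "\<dots> \<le> ?D / m ^ 3 + 1 * (?D * (1 / m ^ 3 + 1 / m ^ 3 + 1 / m ^ 3))"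
  proof (intro add_mono mult_mono)
    show "\<bar>(x1 - x2) / r1 ^ 3\<bar> \<le> ?D / m ^ 3"
      using m r by (auto simp: abs_divide intro!: frac_le power_mono)
    show "\<bar>x2 / r2\<bar> \<le> 1" using x2 r by (simp add: abs_divide)
    show "\<bar>r2 - r1\<bar> \<le> ?D" using D by simp
    have "m ^ 3 \<le> r1 * r2\<^sup>2" "m ^ 3 \<le> r1\<^sup>2 * r2" "m ^ 3 \<le> r1 ^ 3"
      using m r unfolding power3_eq_cube power2_eq_square mult.assoc
      by (auto intro!: mult_mono)
    then have "1 / (r1 * r2\<^sup>2) \<le> 1 / m ^ 3" "1 / (r1\<^sup>2 * r2) \<le> 1 / m ^ 3" "1 / r1 ^ 3 \<le> 1 / m ^ 3"
      using m by (auto intro!: divide_left_mono mult_pos_pos r)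
    then have "1 / (r1 * r2\<^sup>2) + 1 / (r1\<^sup>2 * r2) + 1 / r1 ^ 3 \<le> 1 / m ^ 3 + 1 / m ^ 3 + 1 / m ^ 3"
      by (intro add_mono)
    moreover have "0 \<le> 1 / (r1 * r2\<^sup>2) + 1 / (r1\<^sup>2 * r2) + 1 / r1 ^ 3" using r by simp
    ultimately show "\<bar>1 / (r1 * r2\<^sup>2) + 1 / (r1\<^sup>2 * r2) + 1 / r1 ^ 3\<bar> \<le> 1 / m ^ 3 + 1 / m ^ 3 + 1 / m ^ 3"
      by (simp only: abs_of_nonneg)
  qed auto
  also have "\<dots> = 4 / m ^ 3 * ?D" by (simp add: add_divide_distrib algebra_simps)
  finally show ?thesis .
qed

lemma stark_sol_subset:
  assumes "stark_sol x y u v I" "I' \<subseteq> I"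
  shows "stark_sol x y u v I'"
  using assms unfolding stark_sol_def by (blast intro: DERIV_subset)

text \<open>The distance to the origin is continuous and positive on a compact interval, so its
  minimum is attained and positive.\<close>

lemma stark_sol_radius_bounded_below:
  assumes "stark_sol x y u v {0..T}"
  obtains m where "m > 0" "\<And>t. t \<in> {0..T} \<Longrightarrow> m \<le> sqrt ((x t)\<^sup>2 + (y t)\<^sup>2)"
proof (cases "T \<ge> 0")
  case True
  let ?r = "\<lambda>t. sqrt ((x t)\<^sup>2 + (y t)\<^sup>2)"
  have "continuous_on {0..T} x" "continuous_on {0..T} y"
    using assms by (auto intro!: DERIV_continuous_on simp: stark_sol_def)
  then have "continuous_on {0..T} ?r" by (intro continuous_intros)
  then obtain s where s: "s \<in> {0..T}" "\<And>t. t \<in> {0..T} \<Longrightarrow> ?r s \<le> ?r t"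
    using continuous_attains_inf[of "{0..T}" ?r] True by auto
  have "?r s > 0" using assms s(1) by (auto simp: stark_sol_def sum_power2_gt_zero_iff)
  then show ?thesis using s that by blast
\<comment> \<open>The interval is empty in this case, so any positive value serves.\<close>
qed (use that[of 1] in auto)

text \<open>The field is Lipschitz only away from the origin, so both solutions are first kept at
  distance at least \<open>m\<close> from it. Gronwall's inequality then applies to the squared
  phase-space distance \<open>?w\<close>, which starts at 0.\<close>

lemma stark_sol_unique:
  assumes 1: "stark_sol x1 y1 u1 v1 {0..T}" and 2: "stark_sol x2 y2 u2 v2 {0..T}"
    and init: "x1 0 = x2 0" "y1 0 = y2 0" "u1 0 = u2 0" "v1 0 = v2 0"
    and t: "t \<in> {0..T}"
  shows "x1 t = x2 t \<and> y1 t = y2 t"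
proof -
  obtain m1 where m1: "m1 > 0" "\<And>s. s \<in> {0..T} \<Longrightarrow> m1 \<le> sqrt ((x1 s)\<^sup>2 + (y1 s)\<^sup>2)"
    using stark_sol_radius_bounded_below[OF 1] by blast
  obtain m2 where m2: "m2 > 0" "\<And>s. s \<in> {0..T} \<Longrightarrow> m2 \<le> sqrt ((x2 s)\<^sup>2 + (y2 s)\<^sup>2)"
    using stark_sol_radius_bounded_below[OF 2] by blast
  define m where "m = min m1 m2"
  define L where "L = 4 / m ^ 3"
  have m: "m > 0" using m1 m2 by (simp add: m_def)
  then have L: "L > 0" by (simp add: L_def)
  let ?w = "\<lambda>s. (x1 s - x2 s)\<^sup>2 + (y1 s - y2 s)\<^sup>2 + (u1 s - u2 s)\<^sup>2 + (v1 s - v2 s)\<^sup>2"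
  let ?fx = "\<lambda>s. - x1 s / (sqrt ((x1 s)\<^sup>2 + (y1 s)\<^sup>2)) ^ 3 + x2 s / (sqrt ((x2 s)\<^sup>2 + (y2 s)\<^sup>2)) ^ 3"
  let ?fy = "\<lambda>s. - y1 s / (sqrt ((x1 s)\<^sup>2 + (y1 s)\<^sup>2)) ^ 3 + y2 s / (sqrt ((x2 s)\<^sup>2 + (y2 s)\<^sup>2)) ^ 3"
  let ?w' = "\<lambda>s. 2 * (x1 s - x2 s) * (u1 s - u2 s) + 2 * (y1 s - y2 s) * (v1 s - v2 s)
     + 2 * (u1 s - u2 s) * ?fx s + 2 * (v1 s - v2 s) * ?fy s"
  have "?w t \<le> 0"
  proof (rule gronwall_nonpos[where a = 0 and b = t and w = ?w and w' = ?w' and C = "1 + 2 * L"])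
    fix s assume s: "s \<in> {0..t}"
    have sub: "{0..t} \<subseteq> {0..T}" using t by auto
    have d: "(x1 has_real_derivative u1 s) (at s within {0..t})"
      "(y1 has_real_derivative v1 s) (at s within {0..t})"
      "(u1 has_real_derivative (- x1 s / (sqrt ((x1 s)\<^sup>2 + (y1 s)\<^sup>2)) ^ 3 + 1)) (at s within {0..t})"
      "(v1 has_real_derivative (- y1 s / (sqrt ((x1 s)\<^sup>2 + (y1 s)\<^sup>2)) ^ 3)) (at s within {0..t})"
      "(x2 has_real_derivative u2 s) (at s within {0..t})"
      "(y2 has_real_derivative v2 s) (at s within {0..t})"
      "(u2 has_real_derivative (- x2 s / (sqrt ((x2 s)\<^sup>2 + (y2 s)\<^sup>2)) ^ 3 + 1)) (at s within {0..t})"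
      "(v2 has_real_derivative (- y2 s / (sqrt ((x2 s)\<^sup>2 + (y2 s)\<^sup>2)) ^ 3)) (at s within {0..t})"
      using stark_sol_subset[OF 1 sub] stark_sol_subset[OF 2 sub] s unfolding stark_sol_def by blast+
    show "(?w has_real_derivative ?w' s) (at s within {0..t})"
      by (rule derivative_eq_intros d refl)+ (simp add: algebra_simps)
  next
    fix s assume "0 < s" "s < t"
    then have sT: "s \<in> {0..T}" using t by auto
    have "m \<le> sqrt ((x1 s)\<^sup>2 + (y1 s)\<^sup>2)" "m \<le> sqrt ((x2 s)\<^sup>2 + (y2 s)\<^sup>2)"
      using m1(2)[OF sT] m2(2)[OF sT] by (auto simp: m_def)
    then have fx: "\<bar>?fx s\<bar> \<le> L * (\<bar>x1 s - x2 s\<bar> + \<bar>y1 s - y2 s\<bar>)"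
      and fy: "\<bar>?fy s\<bar> \<le> L * (\<bar>x1 s - x2 s\<bar> + \<bar>y1 s - y2 s\<bar>)"
      using inverse_cube_Lipschitz[OF m, of "x1 s" "y1 s" "x2 s" "y2 s"]
        inverse_cube_Lipschitz[OF m, of "y1 s" "x1 s" "y2 s" "x2 s"]
      by (auto simp: L_def add.commute[of "(y1 s)\<^sup>2"] add.commute[of "(y2 s)\<^sup>2"] abs_minus_commute add.commute)
    define p q z w where pq: "p = \<bar>x1 s - x2 s\<bar>" "q = \<bar>y1 s - y2 s\<bar>" "z = \<bar>u1 s - u2 s\<bar>" "w = \<bar>v1 s - v2 s\<bar>"
    have young: "2 * (b * e) \<le> b\<^sup>2 + e\<^sup>2" for b e :: real
      using sum_squares_bound[of b e] by simp
    have "(x1 s - x2 s) * (u1 s - u2 s) \<le> p * z" "(y1 s - y2 s) * (v1 s - v2 s) \<le> q * w"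
      unfolding pq by (metis abs_ge_self abs_mult)+
    moreover have "(u1 s - u2 s) * ?fx s \<le> z * (L * (p + q))"
    proof -
      have "(u1 s - u2 s) * ?fx s \<le> \<bar>u1 s - u2 s\<bar> * \<bar>?fx s\<bar>" by (metis abs_ge_self abs_mult)
      also have "\<dots> \<le> z * (L * (p + q))" using fx unfolding pq by (intro mult_left_mono) auto
      finally show ?thesis .
    qed
    moreover have "(v1 s - v2 s) * ?fy s \<le> w * (L * (p + q))"
    proof -
      have "(v1 s - v2 s) * ?fy s \<le> \<bar>v1 s - v2 s\<bar> * \<bar>?fy s\<bar>" by (metis abs_ge_self abs_mult)
      also have "\<dots> \<le> w * (L * (p + q))" using fy unfolding pq by (intro mult_left_mono) auto
      finally show ?thesis .
    qed
    ultimately have "?w' s \<le> 2 * (p * z) + 2 * (q * w) + 2 * (z * (L * (p + q))) + 2 * (w * (L * (p + q)))"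
      by linarith
    also have "\<dots> = 2 * (p * z) + 2 * (q * w) + L * (2 * (z * p) + 2 * (z * q) + 2 * (w * p) + 2 * (w * q))"
      by (simp add: algebra_simps)
    \<comment> \<open>Young's inequality removes each mixed product. Every square receives 1 from
      the kinematic terms and \<open>2 * L\<close> from the force terms, hence the Gronwall constant
      \<open>1 + 2 * L\<close>.\<close>
    also have "\<dots> \<le> (p\<^sup>2 + z\<^sup>2) + (q\<^sup>2 + w\<^sup>2) + L * ((z\<^sup>2 + p\<^sup>2) + (z\<^sup>2 + q\<^sup>2) + (w\<^sup>2 + p\<^sup>2) + (w\<^sup>2 + q\<^sup>2))"
      using L by (intro add_mono mult_left_mono young) auto
    also have "\<dots> = (1 + 2 * L) * (p\<^sup>2 + q\<^sup>2 + z\<^sup>2 + w\<^sup>2)" by (simp add: algebra_simps)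
    finally show "?w' s \<le> (1 + 2 * L) * ?w s" by (simp add: pq)
  qed (use init t in auto)
  then have "(x1 t - x2 t)\<^sup>2 = 0" "(y1 t - y2 t)\<^sup>2 = 0"
    by (smt (verit) zero_le_power2)+
  then show ?thesis by simp
qed

text \<open>The first two identities conserve the energy and the component of the Runge-Lenz vector
  along the field, corrected by \<open>y^2 / 2\<close> for the constant force; the right-hand sides
  are their values at rest. The derivative of \<open>r\<close> is recorded for the barrier argument
  on \<open>r + x\<close>.\<close>

lemma stark_brake_conserved:
  assumes sol: "stark_sol x y u v {0..T}" and init: "u 0 = 0" "v 0 = 0" and t: "t \<in> {0..T}"
  defines "r \<equiv> \<lambda>t. sqrt ((x t)\<^sup>2 + (y t)\<^sup>2)"
  shows "((u t)\<^sup>2 + (v t)\<^sup>2) / 2 - 1 / r t - x t = - 1 / r 0 - x 0"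
    and "v t * (x t * v t - y t * u t) - x t / r t + (y t)\<^sup>2 / 2 = - x 0 / r 0 + (y 0)\<^sup>2 / 2"
    and "(r has_real_derivative (x t * u t + y t * v t) / r t) (at t within {0..T})"
proof -
  have d: "(x has_real_derivative u t) (at t within {0..T})"
      "(y has_real_derivative v t) (at t within {0..T})"
      "(u has_real_derivative (- x t / r t ^ 3 + 1)) (at t within {0..T})"
      "(v has_real_derivative (- y t / r t ^ 3)) (at t within {0..T})"
    if "t \<in> {0..T}" for t
    using bspec[OF sol[unfolded stark_sol_def] that] by (simp_all add: r_def)
  have rpos: "r t > 0" if "t \<in> {0..T}" for t
  proof -
    have "(x t, y t) \<noteq> (0, 0)" using bspec[OF sol[unfolded stark_sol_def] that] by blast
    then show ?thesis by (auto simp: r_def sum_power2_gt_zero_iff)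
  qed
  have r2: "(r t)\<^sup>2 = (x t)\<^sup>2 + (y t)\<^sup>2" for t by (simp add: r_def)
  have dr: "(r has_real_derivative (x t * u t + y t * v t) / r t) (at t within {0..T})"
    if "t \<in> {0..T}" for t
  proof -
    have pos: "(x t)\<^sup>2 + (y t)\<^sup>2 > 0" using rpos[OF that] by (simp add: r_def)
    have "((\<lambda>t. (x t)\<^sup>2 + (y t)\<^sup>2) has_real_derivative 2 * (x t * u t + y t * v t)) (at t within {0..T})"
      by (rule DERIV_cong[OF DERIV_add[OF DERIV_power[OF d(1)[OF that], of 2] DERIV_power[OF d(2)[OF that], of 2]]])
        simp
    from DERIV_chain2[OF DERIV_real_sqrt[OF pos] this]
    have "(r has_real_derivative inverse (r t) / 2 * (2 * (x t * u t + y t * v t))) (at t within {0..T})"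
      unfolding r_def .
    then show ?thesis by (rule DERIV_cong) (use rpos[OF that] in \<open>simp add: field_simps\<close>)
  qed
  show "(r has_real_derivative (x t * u t + y t * v t) / r t) (at t within {0..T})"
    by (rule dr[OF t])
  \<comment> \<open>Treating \<open>1 / r\<close> as a function of its own keeps the derivatives
    polynomial; the relation \<open>r t * i t = 1\<close> then makes the derivative of
    \<open>?R\<close> vanish.\<close>
  define i where "i = (\<lambda>t. 1 / r t)"
  have ri: "r t * i t = 1" if "t \<in> {0..T}" for t using rpos[OF that] by (simp add: i_def)
  have di: "(i has_real_derivative - ((x t * u t + y t * v t) * i t ^ 3)) (at t within {0..T})"
    if "t \<in> {0..T}" for t
  proof -
    have "r t \<noteq> 0" using rpos[OF that] by simp
    then show ?thesis
      unfolding i_def by (rule DERIV_cong[OF DERIV_divide[OF DERIV_const dr[OF that]]])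
        (use rpos[OF that] in \<open>simp add: field_simps power3_eq_cube\<close>)
  qed
  have du: "(u has_real_derivative (- x t * i t ^ 3 + 1)) (at t within {0..T})"
    and dv: "(v has_real_derivative (- y t * i t ^ 3)) (at t within {0..T})"
    if "t \<in> {0..T}" for t
    using d(3,4)[OF that] by (auto simp: i_def power_divide)
  let ?H = "\<lambda>t. ((u t)\<^sup>2 + (v t)\<^sup>2) / 2 - i t - x t"
  let ?R = "\<lambda>t. v t * (x t * v t - y t * u t) - x t * i t + (y t)\<^sup>2 / 2"
  have "(?H has_real_derivative 0) (at t within {0..T})" if "t \<in> {0..T}" for t
    by (rule DERIV_cong[OF DERIV_diff[OF DERIV_diff[OF DERIV_cdivide[OF DERIV_add[OF
          DERIV_power[OF du[OF that], of 2] DERIV_power[OF dv[OF that], of 2]], of 2]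
          di[OF that]] d(1)[OF that]]])
      (simp add: algebra_simps add_divide_distrib diff_divide_distrib)
  then obtain C where "\<And>t. t \<in> {0..T} \<Longrightarrow> ?H t = C"
    using has_field_derivative_zero_constant[OF convex_real_interval(5), of 0 T ?H] by blast
  from this[of t] this[of 0] have "?H t = ?H 0" using t by simp
  then show "((u t)\<^sup>2 + (v t)\<^sup>2) / 2 - 1 / r t - x t = - 1 / r 0 - x 0"
    using init by (simp add: i_def)
  have "(?R has_real_derivative 0) (at t within {0..T})" if "t \<in> {0..T}" for t
  proof -
    have "(?R has_real_derivative
       - y t * i t ^ 3 * (x t * v t - y t * u t)
       + (u t * v t + - y t * i t ^ 3 * x t - (v t * u t + (- x t * i t ^ 3 + 1) * y t)) * v t
       - (u t * i t + - ((x t * u t + y t * v t) * i t ^ 3) * x t) + y t * v t) (at t within {0..T})"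
      by (rule DERIV_cong[OF DERIV_add[OF DERIV_diff[OF DERIV_mult[OF dv[OF that]
          DERIV_diff[OF DERIV_mult[OF d(1)[OF that] dv[OF that]] DERIV_mult[OF d(2)[OF that] du[OF that]]]]
          DERIV_mult[OF d(1)[OF that] di[OF that]]] DERIV_cdivide[OF DERIV_power[OF d(2)[OF that], of 2], of 2]]])
        simp
    moreover have "- y t * i t ^ 3 * (x t * v t - y t * u t)
       + (u t * v t + - y t * i t ^ 3 * x t - (v t * u t + (- x t * i t ^ 3 + 1) * y t)) * v t
       - (u t * i t + - ((x t * u t + y t * v t) * i t ^ 3) * x t) + y t * v t
       = u t * i t * (((x t)\<^sup>2 + (y t)\<^sup>2) * i t * i t - 1)"
      by (simp add: algebra_simps power2_eq_square power3_eq_cube)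
    moreover have "((x t)\<^sup>2 + (y t)\<^sup>2) * i t * i t = (r t * i t) * (r t * i t)"
      unfolding r2[symmetric] by (simp add: power2_eq_square)
    ultimately show ?thesis by (simp add: ri[OF that])
  qed
  then obtain C where "\<And>t. t \<in> {0..T} \<Longrightarrow> ?R t = C"
    using has_field_derivative_zero_constant[OF convex_real_interval(5), of 0 T ?R] by blast
  from this[of t] this[of 0] have "?R t = ?R 0" using t by simp
  then show "v t * (x t * v t - y t * u t) - x t / r t + (y t)\<^sup>2 / 2 = - x 0 / r 0 + (y 0)\<^sup>2 / 2"
    using init by (simp add: i_def)
qed

text \<open>For \<open>p = r + x\<close> the two conserved quantities give
  \<open>(r p')\<^sup>2 = p (p - A) (p + A - 2 c)\<close> with \<open>A = p 0\<close>; since \<open>c \<le> A\<close>, below \<open>A\<close> the speed of \<open>p\<close> is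
  at most proportional to \<open>A - p\<close>.\<close>

lemma stark_brake_parabolic_barrier:
  assumes sol: "stark_sol x y u v {0..T}" and T: "T \<ge> 0" and init: "u 0 = 0" "v 0 = 0"
  defines "r \<equiv> \<lambda>t. sqrt ((x t)\<^sup>2 + (y t)\<^sup>2)"
  assumes r0: "r 0 \<ge> 1"
  shows "r 0 + x 0 \<le> r T + x T"
proof (rule ccontr)
  assume contra: "\<not> ?thesis"
  define p where "p = (\<lambda>t. r t + x t)"
  define A where "A = p 0"
  define c where "c = 1 / r 0 + x 0"
  have r2: "(r t)\<^sup>2 = (x t)\<^sup>2 + (y t)\<^sup>2" for t by (simp add: r_def)
  have p0: "p t \<ge> 0" for t
    using real_sqrt_ge_abs1[of "x t" "y t"] unfolding p_def r_def by linarith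
  obtain m where m: "m > 0" "\<And>t. t \<in> {0..T} \<Longrightarrow> m \<le> r t"
    using stark_sol_radius_bounded_below[OF sol] unfolding r_def by blast
  \<comment> \<open>Starting at distance at least 1 puts the second root \<open>2 * c - A\<close> of
    the quadratic factor at or below the root \<open>A\<close>.\<close>
  have "1 / r 0 \<le> r 0" using r0 mult_mono[of 1 "r 0" 1 "r 0"] by (simp add: divide_le_eq)
  then have cA: "c \<le> A" by (simp add: c_def A_def p_def)
  have sq: "(x t * u t + y t * v t + r t * u t)\<^sup>2 = p t * ((p t - A) * (p t + A - 2 * c))"
    if t: "t \<in> {0..T}" for t
  proof -
    note cons = stark_brake_conserved[OF sol init t]
    define i where "i = 1 / r t"
    define i0 where "i0 = 1 / r 0"
    have i: "r t * i = 1" "r 0 * i0 = 1" using m(1) m(2)[OF t] r0 by (auto simp: i_def i0_def)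
    have "((u t)\<^sup>2 + (v t)\<^sup>2) / 2 = i + x t - c"
      using cons(1) by (simp add: i_def c_def r_def algebra_simps)
    then have H: "(u t)\<^sup>2 + (v t)\<^sup>2 = 2 * i + 2 * x t - 2 * c"
      by (simp add: field_simps)
    have "v t * (x t * v t - y t * u t) - x t * i + (y t)\<^sup>2 / 2 = - x 0 * i0 + (y 0)\<^sup>2 / 2"
      using cons(2) by (simp add: r_def i_def i0_def)
    then have R: "2 * v t * (x t * v t - y t * u t) = 2 * x t * i - (y t)\<^sup>2 - 2 * x 0 * i0 + (y 0)\<^sup>2" by (simp add: algebra_simps)
    have c: "c = i0 + x 0" by (simp add: c_def i0_def)
    have "(x t * u t + y t * v t + r t * u t)\<^sup>2
        = p t * (((u t)\<^sup>2 + (v t)\<^sup>2) * p t - 2 * v t * (x t * v t - y t * u t))"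
      unfolding p_def using r2[of t] by algebra
    also have "((u t)\<^sup>2 + (v t)\<^sup>2) * p t - 2 * v t * (x t * v t - y t * u t)
        = (p t)\<^sup>2 - 2 * c * p t + 2 + 2 * x 0 * i0 - (y 0)\<^sup>2"
      unfolding H R p_def using i(1) r2[of t] by algebra
    also have "\<dots> = (p t)\<^sup>2 - 2 * c * p t + 2 * c * A - A\<^sup>2"
    proof -
      have "2 + 2 * x 0 * i0 - (y 0)\<^sup>2 = 2 * c * A - A\<^sup>2"
        unfolding A_def p_def c using i(2) r2[of 0] by algebra
      then show ?thesis by simp
    qed
    also have "\<dots> = (p t - A) * (p t + A - 2 * c)"
      by (simp add: algebra_simps power2_eq_square)
    finally show ?thesis .
  qed
  have dp: "(p has_real_derivative (x t * u t + y t * v t + r t * u t) / r t) (at t within {0..T})"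
    if t: "t \<in> {0..T}" for t
  proof -
    have "(x has_real_derivative u t) (at t within {0..T})" using sol t by (auto simp: stark_sol_def)
    with stark_brake_conserved(3)[OF sol init t]
    have "(p has_real_derivative (x t * u t + y t * v t) / r t + u t) (at t within {0..T})"
      unfolding p_def r_def by (rule DERIV_add)
    then show ?thesis using m(1) m(2)[OF t] by (simp add: field_simps)
  qed
  have cont: "continuous_on {0..T} p" using dp by (rule DERIV_continuous_on)
  \<comment> \<open>Compactness of \<open>S\<close> gives a last time \<open>s\<close> with
    \<open>p s \<ge> A\<close>. After it \<open>p\<close> stays below \<open>A\<close> up to
    \<open>T\<close>, and Gronwall's inequality for \<open>A - p\<close> on \<open>{s..T}\<close>
    starts from a nonpositive value.\<close>
  define S where "S = {t \<in> {0..T}. A \<le> p t}"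
  have "closed S"
    unfolding S_def by (intro continuous_closed_preimage_constant continuous_on_closed_Collect_le cont continuous_intros closed_atLeastAtMost)
  moreover have "bounded S"
    by (rule bounded_subset[OF compact_imp_bounded[OF compact_Icc[of 0 T]]]) (auto simp: S_def)
  ultimately have "compact S" by (simp add: compact_eq_bounded_closed)
  moreover have "0 \<in> S" using T by (simp add: S_def A_def)
  ultimately obtain s where s: "s \<in> S" "\<And>t. t \<in> S \<Longrightarrow> t \<le> s"
    using compact_attains_sup[of S] by blast
  have sT: "0 \<le> s" "s \<le> T" "A \<le> p s" using s(1) by (auto simp: S_def)
  have below: "p t < A" if "s < t" "t \<le> T" for t
    using s(2)[of t] that sT by (force simp: S_def)
  have "A - p T \<le> 0"
  proof (rule gronwall_nonpos[where a = s and b = T and w = "\<lambda>t. A - p t" and C = "sqrt A / m"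
        and w' = "\<lambda>t. - ((x t * u t + y t * v t + r t * u t) / r t)"])
    show "s \<le> T" "A - p s \<le> 0" using sT by auto
    show "((\<lambda>t. A - p t) has_real_derivative - ((x t * u t + y t * v t + r t * u t) / r t)) (at t within {s..T})"
      if "t \<in> {s..T}" for t
    proof -
      have "t \<in> {0..T}" "{s..T} \<subseteq> {0..T}" using that sT by auto
      from DERIV_subset[OF dp[OF this(1)] this(2)] show ?thesis
        by (auto intro!: derivative_eq_intros)
    qed
    fix t assume t: "s < t" "t < T"
    then have t': "t \<in> {0..T}" and pA: "p t < A" using sT below by auto
    define P where "P = x t * u t + y t * v t + r t * u t"
    \<comment> \<open>The factor \<open>p t - A\<close> is negative, and
      \<open>p t + A - 2 * c\<close> is at least \<open>p t - A\<close> because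
      \<open>c \<le> A\<close>. With \<open>0 \<le> p t < A\<close> this bounds the modulus of
      \<open>P\<close> by \<open>sqrt A * (A - p t)\<close>, and \<open>r t \<ge> m\<close> then
      yields the constant \<open>sqrt A / m\<close>.\<close>
    have "(p t - A) * (p t + A - 2 * c) \<le> (p t - A) * (p t - A)"
      using pA cA by (intro mult_left_mono_neg) auto
    then have "P\<^sup>2 \<le> p t * ((p t - A) * (p t - A))"
      unfolding P_def sq[OF t'] using p0 by (rule mult_left_mono)
    also have "\<dots> \<le> A * ((p t - A) * (p t - A))" using pA by (intro mult_right_mono) auto
    also have "\<dots> = (sqrt A * (A - p t))\<^sup>2"
      using p0[of 0] by (simp add: power_mult_distrib A_def) (simp add: power2_eq_square algebra_simps)
    finally have "\<bar>P\<bar> \<le> sqrt A * (A - p t)"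
      using pA p0[of 0] by (intro power2_le_imp_le[of "\<bar>P\<bar>"]) (auto simp: A_def)
    moreover have "- (P / r t) \<le> \<bar>P\<bar> / r t"
      using divide_right_mono[of "- P" "\<bar>P\<bar>" "r t"] m(1) m(2)[OF t'] by simp
    moreover have "\<bar>P\<bar> / r t \<le> \<bar>P\<bar> / m" using m(1) m(2)[OF t'] by (intro divide_left_mono) auto
    moreover have "\<bar>P\<bar> / m \<le> sqrt A * (A - p t) / m"
      using calculation(1) m(1) by (intro divide_right_mono) auto
    ultimately show "- ((x t * u t + y t * v t + r t * u t) / r t) \<le> sqrt A / m * (A - p t)"
      unfolding P_def by simp
  qed
  then show False using contra by (simp add: A_def p_def)
qed

section \<open>Parabolic coordinates\<close>

text \<open>Levi-Civita regularisation: the position is half the complex square of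
  \<open>X + i Y\<close>, read along the time change \<open>s\<close>. The two second-order
  equations do not contain the strength of the attraction; the constant 4 in \<open>energy\<close>
  is what sets it to 1.\<close>

lemma levi_civita_stark_sol:
  fixes X X' Y Y' s :: "real \<Rightarrow> real"
  assumes X: "\<And>\<tau>. (X has_real_derivative X' \<tau>) (at \<tau>)"
    and X': "\<And>\<tau>. (X' has_real_derivative 2 * X \<tau> ^ 3 - 2 * c * X \<tau>) (at \<tau>)"
    and Y: "\<And>\<tau>. (Y has_real_derivative Y' \<tau>) (at \<tau>)"
    and Y': "\<And>\<tau>. (Y' has_real_derivative - 2 * Y \<tau> ^ 3 - 2 * c * Y \<tau>) (at \<tau>)"
    and energy: "\<And>\<tau>. (X' \<tau>)\<^sup>2 + (Y' \<tau>)\<^sup>2 = 4 + X \<tau> ^ 4 - Y \<tau> ^ 4 - 2 * c * ((X \<tau>)\<^sup>2 + (Y \<tau>)\<^sup>2)"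
    and nz: "\<And>t. t \<in> I \<Longrightarrow> (X (s t))\<^sup>2 + (Y (s t))\<^sup>2 > 0"
    and s: "\<And>t. t \<in> I \<Longrightarrow> (s has_real_derivative 1 / ((X (s t))\<^sup>2 + (Y (s t))\<^sup>2)) (at t)"
  shows "stark_sol (\<lambda>t. ((X (s t))\<^sup>2 - (Y (s t))\<^sup>2) / 2) (\<lambda>t. X (s t) * Y (s t))
     (\<lambda>t. (X (s t) * X' (s t) - Y (s t) * Y' (s t)) / ((X (s t))\<^sup>2 + (Y (s t))\<^sup>2))
     (\<lambda>t. (X (s t) * Y' (s t) + Y (s t) * X' (s t)) / ((X (s t))\<^sup>2 + (Y (s t))\<^sup>2)) I"
  unfolding stark_sol_def
proof (intro ballI conjI)
  fix t assume t: "t \<in> I"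
  define \<xi> \<eta> \<xi>' \<eta>' W where defs: "\<xi> = X (s t)" "\<eta> = Y (s t)" "\<xi>' = X' (s t)" "\<eta>' = Y' (s t)" "W = \<xi>\<^sup>2 + \<eta>\<^sup>2"
  have Wt: "(X (s t))\<^sup>2 + (Y (s t))\<^sup>2 = W" by (simp add: defs)
  have W: "W > 0" using nz[OF t] by (simp add: defs)
  have Wnz: "(X (s t))\<^sup>2 + (Y (s t))\<^sup>2 \<noteq> 0" using nz[OF t] by linarith
  note ds = DERIV_subset[OF s[OF t] subset_UNIV, of I]
  have dX: "((\<lambda>t. X (s t)) has_real_derivative \<xi>' / W) (at t within I)"
    using DERIV_chain2[OF X ds] by (simp add: defs)
  have dY: "((\<lambda>t. Y (s t)) has_real_derivative \<eta>' / W) (at t within I)"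
    using DERIV_chain2[OF Y ds] by (simp add: defs)
  have dX': "((\<lambda>t. X' (s t)) has_real_derivative (2 * \<xi> ^ 3 - 2 * c * \<xi>) / W) (at t within I)"
    using DERIV_chain2[OF X' ds] by (simp add: defs)
  have dY': "((\<lambda>t. Y' (s t)) has_real_derivative (- 2 * \<eta> ^ 3 - 2 * c * \<eta>) / W) (at t within I)"
    using DERIV_chain2[OF Y' ds] by (simp add: defs)
  have dX2: "((\<lambda>t. (X (s t))\<^sup>2) has_real_derivative 2 * (\<xi> * \<xi>') / W) (at t within I)"
    by (rule DERIV_cong[OF DERIV_power[OF dX, of 2]]) (simp add: defs(1-4))
  have dY2: "((\<lambda>t. (Y (s t))\<^sup>2) has_real_derivative 2 * (\<eta> * \<eta>') / W) (at t within I)"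
    by (rule DERIV_cong[OF DERIV_power[OF dY, of 2]]) (simp add: defs(1-4))
  have E: "\<xi>'\<^sup>2 + \<eta>'\<^sup>2 = 4 + \<xi> ^ 4 - \<eta> ^ 4 - 2 * c * W" using energy by (simp add: defs)
  have "sqrt (((\<xi>\<^sup>2 - \<eta>\<^sup>2) / 2)\<^sup>2 + (\<xi> * \<eta>)\<^sup>2) = W / 2"
    using W by (intro real_sqrt_unique) (auto simp: defs(5) power2_eq_square field_simps)
  then have r: "sqrt ((((X (s t))\<^sup>2 - (Y (s t))\<^sup>2) / 2)\<^sup>2 + (X (s t) * Y (s t))\<^sup>2) = W / 2"
    by (simp add: defs)
  show "(((X (s t))\<^sup>2 - (Y (s t))\<^sup>2) / 2, X (s t) * Y (s t)) \<noteq> (0, 0)"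
    using nz[OF t] by auto
  show "((\<lambda>t. ((X (s t))\<^sup>2 - (Y (s t))\<^sup>2) / 2) has_real_derivative
      (X (s t) * X' (s t) - Y (s t) * Y' (s t)) / ((X (s t))\<^sup>2 + (Y (s t))\<^sup>2)) (at t within I)"
    unfolding Wt by (rule DERIV_cong[OF DERIV_cdivide[OF DERIV_diff[OF dX2 dY2]]]) (simp add: defs(1-4)[symmetric] diff_divide_distrib)
  show "((\<lambda>t. X (s t) * Y (s t)) has_real_derivative
      (X (s t) * Y' (s t) + Y (s t) * X' (s t)) / ((X (s t))\<^sup>2 + (Y (s t))\<^sup>2)) (at t within I)"
    unfolding Wt by (rule DERIV_cong[OF DERIV_mult[OF dX dY]]) (simp add: defs(1-4)[symmetric] add_divide_distrib ac_simps)
  have dW: "((\<lambda>t. (X (s t))\<^sup>2 + (Y (s t))\<^sup>2) has_real_derivative 2 * (\<xi> * \<xi>' + \<eta> * \<eta>') / W) (at t within I)"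
    by (rule DERIV_cong[OF DERIV_add[OF dX2 dY2]]) (simp add: distrib_left add_divide_distrib)
  have "((\<lambda>t. X (s t) * X' (s t) - Y (s t) * Y' (s t)) has_real_derivative
      (\<xi>'\<^sup>2 - \<eta>'\<^sup>2 + 2 * \<xi> ^ 4 - 2 * c * \<xi>\<^sup>2 + 2 * \<eta> ^ 4 + 2 * c * \<eta>\<^sup>2) / W) (at t within I)"
    by (rule derivative_eq_intros dX dY dX' dY' refl)+
      (use W in \<open>simp add: defs(1-4)[symmetric] divide_simps, simp add: algebra_simps power2_eq_square power3_eq_cube power4_eq_xxxx\<close>)
  from DERIV_divide[OF this dW Wnz]
  have "((\<lambda>t. (X (s t) * X' (s t) - Y (s t) * Y' (s t)) / ((X (s t))\<^sup>2 + (Y (s t))\<^sup>2)) has_real_derivative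
     ((\<xi>'\<^sup>2 - \<eta>'\<^sup>2 + 2 * \<xi> ^ 4 - 2 * c * \<xi>\<^sup>2 + 2 * \<eta> ^ 4 + 2 * c * \<eta>\<^sup>2) / W * W
       - (\<xi> * \<xi>' - \<eta> * \<eta>') * (2 * (\<xi> * \<xi>' + \<eta> * \<eta>') / W)) / (W * W)) (at t within I)"
    by (simp only: defs[symmetric])
  moreover have "((\<xi>'\<^sup>2 - \<eta>'\<^sup>2 + 2 * \<xi> ^ 4 - 2 * c * \<xi>\<^sup>2 + 2 * \<eta> ^ 4 + 2 * c * \<eta>\<^sup>2) / W * W
       - (\<xi> * \<xi>' - \<eta> * \<eta>') * (2 * (\<xi> * \<xi>' + \<eta> * \<eta>') / W)) / (W * W)
     = ((\<xi>'\<^sup>2 - \<eta>'\<^sup>2 + 2 * \<xi> ^ 4 - 2 * c * \<xi>\<^sup>2 + 2 * \<eta> ^ 4 + 2 * c * \<eta>\<^sup>2) * W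
       - 2 * (\<xi> * \<xi>' - \<eta> * \<eta>') * (\<xi> * \<xi>' + \<eta> * \<eta>')) / W ^ 3"
    using W by (simp add: field_simps power3_eq_cube)
  \<comment> \<open>The energy relation \<open>E\<close> eliminates the squared velocities and
    leaves the Coulomb term together with \<open>W ^ 3\<close>, which becomes the unit field after
    division.\<close>
  moreover have "(\<xi>'\<^sup>2 - \<eta>'\<^sup>2 + 2 * \<xi> ^ 4 - 2 * c * \<xi>\<^sup>2 + 2 * \<eta> ^ 4 + 2 * c * \<eta>\<^sup>2) * W
       - 2 * (\<xi> * \<xi>' - \<eta> * \<eta>') * (\<xi> * \<xi>' + \<eta> * \<eta>') = W ^ 3 - 4 * (\<xi>\<^sup>2 - \<eta>\<^sup>2)"
    using E defs(5) by algebra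
  moreover have "(W ^ 3 - 4 * (\<xi>\<^sup>2 - \<eta>\<^sup>2)) / W ^ 3 = - ((\<xi>\<^sup>2 - \<eta>\<^sup>2) / 2) / (W / 2) ^ 3 + 1"
    using W by (simp add: field_simps power3_eq_cube)
  ultimately show "((\<lambda>t. (X (s t) * X' (s t) - Y (s t) * Y' (s t)) / ((X (s t))\<^sup>2 + (Y (s t))\<^sup>2)) has_real_derivative
      - (((X (s t))\<^sup>2 - (Y (s t))\<^sup>2) / 2) / sqrt ((((X (s t))\<^sup>2 - (Y (s t))\<^sup>2) / 2)\<^sup>2 + (X (s t) * Y (s t))\<^sup>2) ^ 3 + 1) (at t within I)"
    unfolding r by (simp only: defs(1,2)[symmetric])
  have "((\<lambda>t. X (s t) * Y' (s t) + Y (s t) * X' (s t)) has_real_derivative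
      (2 * \<xi>' * \<eta>' + 2 * \<xi> ^ 3 * \<eta> - 2 * \<xi> * \<eta> ^ 3 - 4 * c * \<xi> * \<eta>) / W) (at t within I)"
    by (rule derivative_eq_intros dX dY dX' dY' refl)+
      (use W in \<open>simp add: defs(1-4)[symmetric] divide_simps, simp add: algebra_simps power2_eq_square power3_eq_cube power4_eq_xxxx\<close>)
  from DERIV_divide[OF this dW Wnz]
  have "((\<lambda>t. (X (s t) * Y' (s t) + Y (s t) * X' (s t)) / ((X (s t))\<^sup>2 + (Y (s t))\<^sup>2)) has_real_derivative
     ((2 * \<xi>' * \<eta>' + 2 * \<xi> ^ 3 * \<eta> - 2 * \<xi> * \<eta> ^ 3 - 4 * c * \<xi> * \<eta>) / W * W
       - (\<xi> * \<eta>' + \<eta> * \<xi>') * (2 * (\<xi> * \<xi>' + \<eta> * \<eta>') / W)) / (W * W)) (at t within I)"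
    by (simp only: defs[symmetric])
  moreover have "((2 * \<xi>' * \<eta>' + 2 * \<xi> ^ 3 * \<eta> - 2 * \<xi> * \<eta> ^ 3 - 4 * c * \<xi> * \<eta>) / W * W
       - (\<xi> * \<eta>' + \<eta> * \<xi>') * (2 * (\<xi> * \<xi>' + \<eta> * \<eta>') / W)) / (W * W)
     = ((2 * \<xi>' * \<eta>' + 2 * \<xi> ^ 3 * \<eta> - 2 * \<xi> * \<eta> ^ 3 - 4 * c * \<xi> * \<eta>) * W
       - 2 * (\<xi> * \<eta>' + \<eta> * \<xi>') * (\<xi> * \<xi>' + \<eta> * \<eta>')) / W ^ 3"
    using W by (simp add: field_simps power3_eq_cube)
  moreover have "(2 * \<xi>' * \<eta>' + 2 * \<xi> ^ 3 * \<eta> - 2 * \<xi> * \<eta> ^ 3 - 4 * c * \<xi> * \<eta>) * W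
       - 2 * (\<xi> * \<eta>' + \<eta> * \<xi>') * (\<xi> * \<xi>' + \<eta> * \<eta>') = - 8 * \<xi> * \<eta>"
    using E defs(5) by algebra
  moreover have "(- 8 * \<xi> * \<eta>) / W ^ 3 = - (\<xi> * \<eta>) / (W / 2) ^ 3"
    using W by (simp add: field_simps power3_eq_cube)
  ultimately show "((\<lambda>t. (X (s t) * Y' (s t) + Y (s t) * X' (s t)) / ((X (s t))\<^sup>2 + (Y (s t))\<^sup>2)) has_real_derivative
      - (X (s t) * Y (s t)) / sqrt ((((X (s t))\<^sup>2 - (Y (s t))\<^sup>2) / 2)\<^sup>2 + (X (s t) * Y (s t))\<^sup>2) ^ 3) (at t within I)"
    unfolding r by (simp only: defs(1,2)[symmetric])
qed

text \<open>Quarter period of \<open>X\<close> after division by its amplitude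
  \<open>sqrt (r + a)\<close>. The two arguments add up to \<open>2 * (1 / r - r)\<close>, which
  tends to 0 as \<open>r\<close> tends to 1, and the integrand then degenerates at
  \<open>s = 0\<close>.\<close>

definition xi_quarter :: "real \<Rightarrow> real \<Rightarrow> real" where
  "xi_quarter a d = (let r = sqrt (a\<^sup>2 + d\<^sup>2) in quarter_period (2 / r + a - r) (- (r + a)))"

text \<open>The counterpart for \<open>Y\<close>, whose squared amplitude is
  \<open>r - a\<close>.\<close>

definition eta_quarter :: "real \<Rightarrow> real \<Rightarrow> real" where
  "eta_quarter a d = (let r = sqrt (a\<^sup>2 + d\<^sup>2) in quarter_period (2 / r + a + r) (r - a))"

text \<open>\<open>X\<close> and \<open>Y\<close> are the parabolic coordinates, as functions of fictitious time, of the solution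
  released from rest at \<open>(a, d)\<close>; \<open>- c\<close> is its energy and \<open>K\<close>, \<open>L\<close> are the quarter periods.\<close>

locale parabolic_lift =
  fixes a d c K L :: real and X X' Y Y' :: "real \<Rightarrow> real"
  assumes K: "K > 0" and L: "L > 0"
    and init: "((X 0)\<^sup>2 - (Y 0)\<^sup>2) / 2 = a" "X 0 * Y 0 = d" "X' 0 = 0" "Y' 0 = 0"
    and X: "\<And>\<tau>. (X has_real_derivative X' \<tau>) (at \<tau>)"
    and X': "\<And>\<tau>. (X' has_real_derivative 2 * X \<tau> ^ 3 - 2 * c * X \<tau>) (at \<tau>)"
    and Y: "\<And>\<tau>. (Y has_real_derivative Y' \<tau>) (at \<tau>)"
    and Y': "\<And>\<tau>. (Y' has_real_derivative - 2 * Y \<tau> ^ 3 - 2 * c * Y \<tau>) (at \<tau>)"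
    and energy: "\<And>\<tau>. (X' \<tau>)\<^sup>2 + (Y' \<tau>)\<^sup>2 = 4 + X \<tau> ^ 4 - Y \<tau> ^ 4 - 2 * c * ((X \<tau>)\<^sup>2 + (Y \<tau>)\<^sup>2)"
    and X_pos: "\<And>\<tau>. \<bar>\<tau>\<bar> < K \<Longrightarrow> X \<tau> > 0"
    and X_zero: "\<And>\<tau>. X \<tau> = 0 \<longleftrightarrow> (\<exists>n::int. odd n \<and> \<tau> = of_int n * K)"
    and Y_zero: "\<And>\<tau>. Y \<tau> = 0 \<longleftrightarrow> d = 0 \<or> (\<exists>n::int. odd n \<and> \<tau> = of_int n * L)"
    and X_per: "\<And>\<tau>. X (\<tau> + 4 * K) = X \<tau>" "\<And>\<tau>. X' (\<tau> + 4 * K) = X' \<tau>"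
    and Y_per: "\<And>\<tau>. Y (\<tau> + 4 * L) = Y \<tau>" "\<And>\<tau>. Y' (\<tau> + 4 * L) = Y' \<tau>"
    and Y'_even: "\<And>n::int. even n \<Longrightarrow> Y' (of_int n * L) = 0"
begin

text \<open>Twice the distance to the origin, and at the same time the rate of physical against
  fictitious time.\<close>

definition W :: "real \<Rightarrow> real" where "W \<tau> = (X \<tau>)\<^sup>2 + (Y \<tau>)\<^sup>2"
definition pos_x :: "real \<Rightarrow> real" where "pos_x \<tau> = ((X \<tau>)\<^sup>2 - (Y \<tau>)\<^sup>2) / 2"
definition pos_y :: "real \<Rightarrow> real" where "pos_y \<tau> = X \<tau> * Y \<tau>"
definition vel_x :: "real \<Rightarrow> real" where "vel_x \<tau> = (X \<tau> * X' \<tau> - Y \<tau> * Y' \<tau>) / W \<tau>"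
definition vel_y :: "real \<Rightarrow> real" where "vel_y \<tau> = (X \<tau> * Y' \<tau> + Y \<tau> * X' \<tau>) / W \<tau>"

lemma initial: "pos_x 0 = a" "pos_y 0 = d" "vel_x 0 = 0" "vel_y 0 = 0"
  using init by (auto simp: pos_x_def pos_y_def vel_x_def vel_y_def)

lemma W_pos: "\<bar>\<tau>\<bar> < K \<Longrightarrow> W \<tau> > 0"
  using X_pos[of \<tau>] by (simp add: W_def sum_power2_gt_zero_iff)

lemma isCont_W: "isCont W \<tau>"
  unfolding W_def using DERIV_isCont[OF X] DERIV_isCont[OF Y] by (intro continuous_intros)

lemma stark_sol_lift:
  assumes "\<And>t. t \<in> I \<Longrightarrow> W (s t) > 0"
    and "\<And>t. t \<in> I \<Longrightarrow> (s has_real_derivative 1 / W (s t)) (at t)"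
  shows "stark_sol (\<lambda>t. pos_x (s t)) (\<lambda>t. pos_y (s t)) (\<lambda>t. vel_x (s t)) (\<lambda>t. vel_y (s t)) I"
  unfolding pos_x_def pos_y_def vel_x_def vel_y_def W_def
  using levi_civita_stark_sol[OF X X' Y Y' energy] assms unfolding W_def by blast

text \<open>Until its first zero at \<open>K\<close> the coordinate \<open>X\<close> is positive, so
  the orbit meets the x-axis only where \<open>Y\<close> vanishes, and there
  \<open>x = X^2 / 2 > 0\<close>.\<close>

lemma positive_axis_iff:
  assumes "\<bar>\<tau>\<bar> < K"
  shows "pos_y \<tau> = 0 \<and> pos_x \<tau> > 0 \<longleftrightarrow> Y \<tau> = 0"
  using X_pos[OF assms] by (auto simp: pos_x_def pos_y_def)

lemma no_negative_axis:
  assumes "\<bar>\<tau>\<bar> < K"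
  shows "\<not> (pos_y \<tau> = 0 \<and> pos_x \<tau> < 0)"
  using positive_axis_iff[OF assms] X_pos[OF assms] by (auto simp: pos_y_def)

text \<open>Physical time on the stretch before \<open>X\<close> first vanishes. At a collision
  \<open>W\<close> vanishes at \<open>K\<close>, so \<open>s\<close> is differentiated only before
  \<open>\<Phi> K\<close>, and at the end point just its limit is kept.\<close>

lemma local_clock:
  obtains \<Phi> s where "\<Phi> 0 = 0" "strict_mono_on {0..K} \<Phi>" "\<And>\<tau>. \<tau> \<in> {0..K} \<Longrightarrow> s (\<Phi> \<tau>) = \<tau>"
    "\<And>t. t \<in> {0..<\<Phi> K} \<Longrightarrow> s t \<in> {0..<K} \<and> \<Phi> (s t) = t"
    "\<And>t. t \<in> {0..<\<Phi> K} \<Longrightarrow> (s has_real_derivative 1 / W (s t)) (at t)"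
    "(s \<longlongrightarrow> K) (at_left (\<Phi> K))"
proof -
  obtain \<Phi> where \<Phi>0: "\<Phi> 0 = 0" and \<Phi>: "\<And>\<tau>. (\<Phi> has_real_derivative W \<tau>) (at \<tau>)"
    using continuous_antiderivative[OF isCont_W] by blast
  have cont: "continuous_on S \<Phi>" for S
    using \<Phi> by (intro continuous_at_imp_continuous_on) (auto intro: DERIV_isCont)
  \<comment> \<open>The symmetric interval makes 0 an interior point, so that the inverse has a
    two-sided derivative at time 0. Positivity of \<open>W\<close> enters only strictly
    inside.\<close>
  have mono: "strict_mono_on {-K..K} \<Phi>"
  proof (rule strict_mono_onI)
    fix p q assume pq: "p \<in> {-K..K}" "q \<in> {-K..K}" "p < q"
    show "\<Phi> p < \<Phi> q"
    proof (rule DERIV_pos_imp_increasing_open[OF \<open>p < q\<close> _ cont])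
      fix z assume "p < z" "z < q"
      then show "\<exists>y. (\<Phi> has_real_derivative y) (at z) \<and> y > 0"
        using \<Phi>[of z] W_pos[of z] pq by (intro exI[of _ "W z"]) auto
    qed
  qed
  define s where "s = inv_into {-K..K} \<Phi>"
  have s\<Phi>: "s (\<Phi> \<tau>) = \<tau>" if "\<tau> \<in> {-K..K}" for \<tau>
    unfolding s_def using that by (intro inv_into_f_f strict_mono_on_imp_inj_on[OF mono])
  have inv: "s t \<in> {0..K} \<and> \<Phi> (s t) = t" if t: "t \<in> {0..\<Phi> K}" for t
  proof -
    have "\<exists>\<tau>\<ge>0. \<tau> \<le> K \<and> \<Phi> \<tau> = t"
      using t K \<Phi>0 \<Phi> by (intro IVT) (auto intro: DERIV_isCont)
    then obtain \<tau> where "\<tau> \<in> {0..K}" "\<Phi> \<tau> = t" by auto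
    then show ?thesis using s\<Phi>[of \<tau>] by auto
  qed
  have inv': "s t \<in> {0..<K} \<and> \<Phi> (s t) = t" if t: "t \<in> {0..<\<Phi> K}" for t
    using inv[of t] t by (cases "s t = K") auto
  have "\<Phi> K > 0" using strict_mono_onD[OF mono, of 0 K] K \<Phi>0 by simp
  show thesis
  proof (rule that)
    show "\<Phi> 0 = 0" by fact
    show "strict_mono_on {0..K} \<Phi>" using mono K by (auto simp: strict_mono_on_def)
    show "s (\<Phi> \<tau>) = \<tau>" if "\<tau> \<in> {0..K}" for \<tau> using s\<Phi>[of \<tau>] that by auto
    show "s t \<in> {0..<K} \<and> \<Phi> (s t) = t" if "t \<in> {0..<\<Phi> K}" for t using inv' that .
    show "(s has_real_derivative 1 / W (s t)) (at t)" if t: "t \<in> {0..<\<Phi> K}" for t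
    proof -
      have st: "s t \<in> {-K<..<K}" "\<Phi> (s t) = t" using inv'[OF t] K by auto
      have "\<bar>s t\<bar> < K" using st by (simp add: abs_less_iff)
      then have "W (s t) \<noteq> 0" using W_pos[of "s t"] by simp
      then have "(s has_real_derivative inverse (W (s t))) (at (\<Phi> (s t)))"
        using st s\<Phi> by (intro has_field_derivative_inverse_strong[OF \<Phi>, where S = "{-K<..<K}"] cont) auto
      then show ?thesis by (simp add: st inverse_eq_divide)
    qed
    have "continuous_on (\<Phi> ` {0..K}) s"
      by (rule continuous_on_inv[OF cont compact_Icc]) (use s\<Phi> K in auto)
    moreover have "{0..\<Phi> K} \<subseteq> \<Phi> ` {0..K}" using inv by (metis image_eqI subsetI)
    ultimately have "continuous_on {0..\<Phi> K} s" by (rule continuous_on_subset)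
    then have "(s \<longlongrightarrow> s (\<Phi> K)) (at (\<Phi> K) within {0..\<Phi> K})"
      using \<open>\<Phi> K > 0\<close> by (auto simp: continuous_on_def)
    then show "(s \<longlongrightarrow> K) (at_left (\<Phi> K))"
      using s\<Phi>[of K] K at_within_Icc_at_left[OF \<open>\<Phi> K > 0\<close>] by simp
  qed
qed

text \<open>Crossings happen at the odd multiples of \<open>L\<close> strictly between 0 and
  \<open>K\<close>, and the bounds \<open>k\<close> leave exactly \<open>k\<close> of them. Equality
  on the right is allowed because for \<open>K = (2 * k + 1) * L\<close> the next zero of
  \<open>Y\<close> is the collision itself, which is not counted.\<close>

lemma positive_axis_crossings:
  assumes d: "d \<noteq> 0" and \<Phi>0: "\<Phi> 0 = 0" and mono: "strict_mono_on {0..K} \<Phi>"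
    and s\<Phi>: "\<And>\<tau>. \<tau> \<in> {0..K} \<Longrightarrow> s (\<Phi> \<tau>) = \<tau>"
    and \<Phi>s: "\<And>t. t \<in> {0..<\<Phi> K} \<Longrightarrow> s t \<in> {0..<K} \<and> \<Phi> (s t) = t"
    and k: "(2 * real k - 1) * L < K" "K \<le> (2 * real k + 1) * L"
  shows "finite (pos_axis_times (\<lambda>t. pos_x (s t)) (\<lambda>t. pos_y (s t)) (\<Phi> K))"
    and "card (pos_axis_times (\<lambda>t. pos_x (s t)) (\<lambda>t. pos_y (s t)) (\<Phi> K)) = k"
proof -
  define \<tau> where "\<tau> = (\<lambda>j. (2 * real j + 1) * L)"
  have \<tau>: "\<tau> j \<in> {0<..<K}" if "j < k" for j
  proof -
    have "\<tau> j \<le> (2 * real k - 1) * L" unfolding \<tau>_def using that L by (intro mult_right_mono) auto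
    moreover have "0 < \<tau> j" using L by (simp add: \<tau>_def)
    ultimately show ?thesis using k by simp
  qed
  have eq: "pos_axis_times (\<lambda>t. pos_x (s t)) (\<lambda>t. pos_y (s t)) (\<Phi> K) = (\<lambda>j. \<Phi> (\<tau> j)) ` {..<k}"
  proof (intro equalityI subsetI)
    fix t assume "t \<in> pos_axis_times (\<lambda>t. pos_x (s t)) (\<lambda>t. pos_y (s t)) (\<Phi> K)"
    then have t: "0 < t" "t < \<Phi> K" "pos_y (s t) = 0 \<and> pos_x (s t) > 0"
      by (auto simp: pos_axis_times_def)
    then have st: "0 \<le> s t" "s t < K" "\<Phi> (s t) = t" using \<Phi>s[of t] by auto
    then have "0 < s t" using t \<Phi>0 by (cases "s t = 0") auto
    have "Y (s t) = 0" using positive_axis_iff[of "s t"] t st by auto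
    then obtain n :: int where n: "odd n" "s t = of_int n * L" using Y_zero d by auto
    have "0 < n" using n(2) \<open>0 < s t\<close> L by (simp add: zero_less_mult_iff)
    have "of_int n * L < (2 * real k + 1) * L" using n(2) st k by linarith
    then have "of_int n < (2 * real k + 1)" using L by simp
    then have "n < 2 * int k + 1" by linarith
    from \<open>odd n\<close> obtain i where "n = 2 * i + 1" by (rule oddE)
    moreover define j where "j = nat i"
    ultimately have "n = 2 * int j + 1" "j < k"
      using \<open>0 < n\<close> \<open>n < 2 * int k + 1\<close> by linarith+
    then have "t = \<Phi> (\<tau> j)" using n(2) st by (simp add: \<tau>_def)
    then show "t \<in> (\<lambda>j. \<Phi> (\<tau> j)) ` {..<k}" using \<open>j < k\<close> by blast
  next
    fix t assume "t \<in> (\<lambda>j. \<Phi> (\<tau> j)) ` {..<k}"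
    then obtain j where j: "j < k" "t = \<Phi> (\<tau> j)" by auto
    note \<tau>j = \<tau>[OF j(1)]
    then have \<tau>K: "\<tau> j \<in> {0..K}" "\<bar>\<tau> j\<bar> < K" by auto
    have st: "s t = \<tau> j" unfolding j(2) by (rule s\<Phi>[OF \<tau>K(1)])
    have "Y (\<tau> j) = 0" unfolding Y_zero by (rule disjI2, rule exI[of _ "2 * int j + 1"]) (simp add: \<tau>_def)
    then have "pos_y (s t) = 0 \<and> pos_x (s t) > 0" using positive_axis_iff[OF \<tau>K(2)] st by simp
    moreover have "\<Phi> 0 < \<Phi> (\<tau> j)" "\<Phi> (\<tau> j) < \<Phi> K"
      using \<tau>j \<tau>K by (simp_all add: strict_mono_onD[OF mono])
    ultimately show "t \<in> pos_axis_times (\<lambda>t. pos_x (s t)) (\<lambda>t. pos_y (s t)) (\<Phi> K)"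
      using \<Phi>0 j by (simp add: pos_axis_times_def)
  qed
  have "inj_on (\<lambda>j. \<Phi> (\<tau> j)) {..<k}"
  proof (rule inj_onI)
    fix i j assume ij: "i \<in> {..<k}" "j \<in> {..<k}" "\<Phi> (\<tau> i) = \<Phi> (\<tau> j)"
    have "\<tau> i \<in> {0..K}" "\<tau> j \<in> {0..K}" using \<tau>[of i] \<tau>[of j] ij by auto
    then have "\<tau> i = \<tau> j" using s\<Phi> ij(3) by metis
    then show "i = j" using L by (simp add: \<tau>_def)
  qed
  then show "card (pos_axis_times (\<lambda>t. pos_x (s t)) (\<lambda>t. pos_y (s t)) (\<Phi> K)) = k"
    by (simp add: eq card_image)
  show "finite (pos_axis_times (\<lambda>t. pos_x (s t)) (\<lambda>t. pos_y (s t)) (\<Phi> K))"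
    by (simp add: eq)
qed

text \<open>\<open>K\<close> is the first positive zero of \<open>X\<close> and an odd multiple of
  \<open>L\<close>, so both parabolic coordinates vanish there together and the position tends to
  the origin in the finite time \<open>\<Phi> K\<close>.\<close>

lemma collision_orbit_lift:
  assumes d: "d \<noteq> 0" and KL: "K = (2 * real k + 1) * L"
  shows "collision_orbit_k a d k"
proof -
  obtain \<Phi> s where \<Phi>0: "\<Phi> 0 = 0"
    and mono: "strict_mono_on {0..K} \<Phi>" and s\<Phi>: "\<And>\<tau>. \<tau> \<in> {0..K} \<Longrightarrow> s (\<Phi> \<tau>) = \<tau>"
    and \<Phi>s: "\<And>t. t \<in> {0..<\<Phi> K} \<Longrightarrow> s t \<in> {0..<K} \<and> \<Phi> (s t) = t"
    and ds: "\<And>t. t \<in> {0..<\<Phi> K} \<Longrightarrow> (s has_real_derivative 1 / W (s t)) (at t)"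
    and lim: "(s \<longlongrightarrow> K) (at_left (\<Phi> K))"
    by (rule local_clock) (rule that)
  have T: "\<Phi> K > 0" using strict_mono_onD[OF mono, of 0 K] K \<Phi>0 by simp
  have s0: "s 0 = 0" using s\<Phi>[of 0] K \<Phi>0 by simp
  have "stark_sol (\<lambda>t. pos_x (s t)) (\<lambda>t. pos_y (s t)) (\<lambda>t. vel_x (s t)) (\<lambda>t. vel_y (s t)) {0..<\<Phi> K}"
    using \<Phi>s ds by (intro stark_sol_lift W_pos) auto
  moreover have "((\<lambda>t. (pos_x (s t), pos_y (s t))) \<longlongrightarrow> (0, 0)) (at_left (\<Phi> K))"
  proof -
    have XY: "X K = 0" "Y K = 0"
      unfolding X_zero Y_zero by (rule exI[of _ 1], simp) (rule disjI2, rule exI[of _ "2 * int k + 1"], simp add: KL)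
    have "isCont pos_x K" "isCont pos_y K"
      unfolding pos_x_def pos_y_def using DERIV_isCont[OF X] DERIV_isCont[OF Y] by (intro continuous_intros; simp)+
    then have "((\<lambda>t. pos_x (s t)) \<longlongrightarrow> pos_x K) (at_left (\<Phi> K))" "((\<lambda>t. pos_y (s t)) \<longlongrightarrow> pos_y K) (at_left (\<Phi> K))"
      using lim by (auto intro: isCont_tendsto_compose)
    moreover have "pos_x K = 0" "pos_y K = 0" using XY by (auto simp: pos_x_def pos_y_def)
    ultimately show ?thesis by (auto intro: tendsto_Pair)
  qed
  moreover have k: "(2 * real k - 1) * L < K" "K \<le> (2 * real k + 1) * L"
    using L by (auto simp: KL)
  moreover have "pos_x (s 0) = a \<and> pos_y (s 0) = d \<and> vel_x (s 0) = 0 \<and> vel_y (s 0) = 0"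
    by (simp add: s0 initial)
  ultimately show ?thesis
    unfolding collision_orbit_k_def using positive_axis_crossings[OF d \<Phi>0 mono s\<Phi> \<Phi>s k] T by blast
qed

text \<open>At \<open>K\<close> the coordinate \<open>X\<close> vanishes while \<open>Y\<close> is
  at a turning point, so \<open>X * X' - Y * Y' = 0\<close> and the negative axis is met
  perpendicularly. The coordinates share the period \<open>4 * K\<close>, which is
  \<open>2 * k\<close> times the period \<open>4 * L\<close> of \<open>Y\<close>.\<close>

lemma brake_orbit_lift:
  assumes d: "d \<noteq> 0" and KL: "K = 2 * real k * L"
  shows "brake_orbit_k a d k"
proof -
  have Yper: "Y (\<tau> + 4 * K) = Y \<tau>" "Y' (\<tau> + 4 * K) = Y' \<tau>" for \<tau>
  proof -
    have "Y (\<tau> + real m * (4 * L)) = Y \<tau> \<and> Y' (\<tau> + real m * (4 * L)) = Y' \<tau>" for m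
    proof (induction m)
      case (Suc m)
      then show ?case using Y_per[of "\<tau> + real m * (4 * L)"] by (simp add: algebra_simps)
    qed simp
    from this[of "2 * k"] show "Y (\<tau> + 4 * K) = Y \<tau>" "Y' (\<tau> + 4 * K) = Y' \<tau>"
      by (auto simp: KL algebra_simps)
  qed
  \<comment> \<open>Collisions are excluded by parity: a common zero would be an odd multiple of
    \<open>L\<close> and also a multiple of \<open>2 * k * L\<close>. Hence the clock is defined for
    all times.\<close>
  have Wpos: "W \<tau> > 0" for \<tau>
  proof (rule ccontr)
    assume "\<not> W \<tau> > 0"
    then have "X \<tau> = 0" "Y \<tau> = 0" unfolding W_def by (auto simp: sum_power2_gt_zero_iff)
    then obtain n m :: int where "\<tau> = of_int n * K" "odd m" "\<tau> = of_int m * L"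
      using X_zero[of \<tau>] Y_zero[of \<tau>] d by blast
    then have "of_int m * L = of_int (2 * int k * n) * L" by (simp add: KL ac_simps)
    then have "m = 2 * int k * n" using L by (metis mult_cancel_right less_irrefl of_int_eq_iff)
    then show False using \<open>odd m\<close> by simp
  qed
  have Wper: "W (\<tau> + 4 * K) = W \<tau>" for \<tau> by (simp add: W_def X_per Yper)
  have K4: "4 * K > 0" using K by simp
  obtain \<Phi> s P where \<Phi>0: "\<Phi> 0 = 0" and "\<And>x. (\<Phi> has_real_derivative W x) (at x)"
    and mono: "strict_mono \<Phi>"
    and s\<Phi>: "\<And>x. s (\<Phi> x) = x" and \<Phi>s: "\<And>t. \<Phi> (s t) = t"
    and ds: "\<And>t. (s has_real_derivative 1 / W (s t)) (at t)"
    and P: "P > 0" "\<And>x. \<Phi> (x + 4 * K) = \<Phi> x + P" "\<And>t. s (t + P) = s t + 4 * K"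
    by (rule periodic_clock[OF isCont_W Wpos Wper K4]) (rule that)
  have s0: "s 0 = 0" using s\<Phi>[of 0] \<Phi>0 by simp
  have T: "\<Phi> K > 0" using strict_monoD[OF mono K] \<Phi>0 by simp
  have mono': "strict_mono_on {0..K} \<Phi>" using mono by (auto simp: strict_mono_on_def strict_mono_def)
  have range: "s t \<in> {0..<K}" if "t \<in> {0..<\<Phi> K}" for t
    using that \<Phi>0 \<Phi>s[of t] strict_mono_less[OF mono, of "s t" K] strict_mono_less_eq[OF mono, of 0 "s t"] by auto
  have \<Phi>s': "s t \<in> {0..<K} \<and> \<Phi> (s t) = t" if "t \<in> {0..<\<Phi> K}" for t
    using range[OF that] \<Phi>s by blast
  have k: "(2 * real k - 1) * L < K" "K \<le> (2 * real k + 1) * L"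
    using L by (auto simp: KL)
  have sol: "stark_sol (\<lambda>t. pos_x (s t)) (\<lambda>t. pos_y (s t)) (\<lambda>t. vel_x (s t)) (\<lambda>t. vel_y (s t)) UNIV"
    using Wpos ds by (intro stark_sol_lift) auto
  have XK: "X K = 0" unfolding X_zero by (rule exI[of _ 1]) simp
  have YK: "Y K \<noteq> 0" using Wpos[of K] XK by (simp add: W_def)
  have Y'K: "Y' K = 0" using Y'_even[of "2 * int k"] by (simp add: KL)
  have end_point: "pos_y K = 0" "pos_x K < 0" "vel_x K = 0"
    using XK YK Y'K by (auto simp: pos_x_def pos_y_def vel_x_def)
  have per: "\<forall>t. pos_x (s (t + P)) = pos_x (s t) \<and> pos_y (s (t + P)) = pos_y (s t)
      \<and> vel_x (s (t + P)) = vel_x (s t) \<and> vel_y (s (t + P)) = vel_y (s t)"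
    by (simp add: P pos_x_def pos_y_def vel_x_def vel_y_def W_def X_per Yper)
  have neg: "\<forall>t\<in>{0<..<\<Phi> K}. \<not> (pos_y (s t) = 0 \<and> pos_x (s t) < 0)"
  proof
    fix t assume "t \<in> {0<..<\<Phi> K}"
    then have "\<bar>s t\<bar> < K" using range[of t] by auto
    then show "\<not> (pos_y (s t) = 0 \<and> pos_x (s t) < 0)" by (rule no_negative_axis)
  qed
  show ?thesis
    unfolding brake_orbit_k_def
  proof (rule exI[of _ "\<lambda>t. pos_x (s t)"], rule exI[of _ "\<lambda>t. pos_y (s t)"],
      rule exI[of _ "\<lambda>t. vel_x (s t)"], rule exI[of _ "\<lambda>t. vel_y (s t)"], intro conjI)
    show "\<exists>P>0. \<forall>t. pos_x (s (t + P)) = pos_x (s t) \<and> pos_y (s (t + P)) = pos_y (s t)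
      \<and> vel_x (s (t + P)) = vel_x (s t) \<and> vel_y (s (t + P)) = vel_y (s t)"
      using P(1) per by blast
    show "\<exists>T>0. pos_y (s T) = 0 \<and> pos_x (s T) < 0 \<and> vel_x (s T) = 0 \<and>
        finite (pos_axis_times (\<lambda>t. pos_x (s t)) (\<lambda>t. pos_y (s t)) T) \<and>
        card (pos_axis_times (\<lambda>t. pos_x (s t)) (\<lambda>t. pos_y (s t)) T) = k \<and>
        (\<forall>t\<in>{0<..<T}. \<not> (pos_y (s t) = 0 \<and> pos_x (s t) < 0))"
      using positive_axis_crossings[OF d \<Phi>0 mono' s\<Phi> \<Phi>s' k] T end_point s\<Phi>[of K] neg
      by (intro exI[of _ "\<Phi> K"]) simp
  qed (use sol initial s0 in auto)
qed

text \<open>By uniqueness the given solution follows the lifted one before \<open>\<Phi> K\<close>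
  and cannot meet the negative axis earlier. By then it has crossed the positive axis at the
  fictitious times \<open>L\<close>, \<open>3 * L\<close> up to \<open>(2 * k + 1) * L\<close>,
  which are \<open>k + 1\<close> in number.\<close>

lemma many_crossings_not_brake_orbit:
  assumes KL: "(2 * real k + 1) * L < K"
  shows "\<not> brake_orbit_k a d k"
proof
  assume "brake_orbit_k a d k"
  then obtain x y u v T where sol: "stark_sol x y u v UNIV"
    and i: "x 0 = a" "y 0 = d" "u 0 = 0" "v 0 = 0" and T: "T > 0" "y T = 0" "x T < 0"
    and fin: "finite (pos_axis_times x y T)" and card: "card (pos_axis_times x y T) = k"
    unfolding brake_orbit_k_def by blast
  obtain \<Phi> s where \<Phi>0: "\<Phi> 0 = 0"
    and mono: "strict_mono_on {0..K} \<Phi>" and s\<Phi>: "\<And>\<tau>. \<tau> \<in> {0..K} \<Longrightarrow> s (\<Phi> \<tau>) = \<tau>"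
    and \<Phi>s: "\<And>t. t \<in> {0..<\<Phi> K} \<Longrightarrow> s t \<in> {0..<K} \<and> \<Phi> (s t) = t"
    and ds: "\<And>t. t \<in> {0..<\<Phi> K} \<Longrightarrow> (s has_real_derivative 1 / W (s t)) (at t)"
    and "(s \<longlongrightarrow> K) (at_left (\<Phi> K))"
    by (rule local_clock) (rule that)
  have s0: "s 0 = 0" using s\<Phi>[of 0] K \<Phi>0 by simp
  have agree: "x t = pos_x (s t) \<and> y t = pos_y (s t)" if t: "t \<in> {0..<\<Phi> K}" for t
  proof -
    have 1: "stark_sol x y u v {0..t}" using sol by (rule stark_sol_subset) simp
    have "\<tau> \<in> {0..<\<Phi> K}" if "\<tau> \<in> {0..t}" for \<tau> using that t by auto
    then have 2: "stark_sol (\<lambda>t. pos_x (s t)) (\<lambda>t. pos_y (s t)) (\<lambda>t. vel_x (s t)) (\<lambda>t. vel_y (s t)) {0..t}"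
      using \<Phi>s ds by (intro stark_sol_lift W_pos) fastforce+
    show ?thesis using stark_sol_unique[OF 1 2] i s0 initial t by simp
  qed
  have TK: "T \<ge> \<Phi> K"
  proof (rule ccontr)
    assume "\<not> T \<ge> \<Phi> K"
    then have t: "T \<in> {0..<\<Phi> K}" using T by simp
    then have "\<bar>s T\<bar> < K" using \<Phi>s[of T] by auto
    then show False using no_negative_axis agree[OF t] T by auto
  qed
  define \<tau> where "\<tau> = (\<lambda>j. (2 * real j + 1) * L)"
  have \<tau>: "\<tau> j \<in> {0<..<K}" if "j \<le> k" for j
  proof -
    have "\<tau> j \<le> (2 * real k + 1) * L" unfolding \<tau>_def using that L by (intro mult_right_mono) auto
    moreover have "0 < \<tau> j" using L by (simp add: \<tau>_def)
    ultimately show ?thesis using KL by simp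
  qed
  have "(\<lambda>j. \<Phi> (\<tau> j)) ` {..k} \<subseteq> pos_axis_times x y T"
  proof
    fix t assume "t \<in> (\<lambda>j. \<Phi> (\<tau> j)) ` {..k}"
    then obtain j where j: "j \<le> k" "t = \<Phi> (\<tau> j)" by auto
    note \<tau>j = \<tau>[OF j(1)]
    then have \<tau>K: "\<tau> j \<in> {0..K}" "\<bar>\<tau> j\<bar> < K" by auto
    have st: "s t = \<tau> j" unfolding j(2) by (rule s\<Phi>[OF \<tau>K(1)])
    have "Y (\<tau> j) = 0" unfolding Y_zero by (rule disjI2, rule exI[of _ "2 * int j + 1"]) (simp add: \<tau>_def)
    then have "pos_y (s t) = 0 \<and> pos_x (s t) > 0" using positive_axis_iff[OF \<tau>K(2)] st by simp
    moreover have "\<Phi> 0 < \<Phi> (\<tau> j)" "\<Phi> (\<tau> j) < \<Phi> K"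
      using \<tau>j \<tau>K by (simp_all add: strict_mono_onD[OF mono])
    ultimately show "t \<in> pos_axis_times x y T"
      using \<Phi>0 j TK agree[of t] by (simp add: pos_axis_times_def)
  qed
  from card_mono[OF fin this] have "card ((\<lambda>j. \<Phi> (\<tau> j)) ` {..k}) \<le> k" by (simp add: card)
  moreover have "inj_on (\<lambda>j. \<Phi> (\<tau> j)) {..k}"
  proof (rule inj_onI)
    fix i j assume ij: "i \<in> {..k}" "j \<in> {..k}" "\<Phi> (\<tau> i) = \<Phi> (\<tau> j)"
    have "\<tau> i \<in> {0..K}" "\<tau> j \<in> {0..K}" using \<tau>[of i] \<tau>[of j] ij by auto
    then have "\<tau> i = \<tau> j" using s\<Phi> ij(3) by metis
    then show "i = j" using L by (simp add: \<tau>_def)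
  qed
  ultimately show False by (simp add: card_image)
qed

end

text \<open>\<open>X\<close> and \<open>Y\<close> are normalised oscillators scaled by
  \<open>A\<close> and \<open>B\<close> with \<open>A^2 = r + a\<close> and
  \<open>B^2 = r - a\<close>. The condition \<open>r < 1\<close> amounts to \<open>A^2 < c\<close>,
  so \<open>X\<close> is released inside the well bounded by the unstable equilibria
  \<open>X^2 = c\<close>; \<open>r + a > 0\<close> makes \<open>A\<close> positive.\<close>

lemma parabolic_lift_exists:
  fixes a d :: real
  defines "r \<equiv> sqrt (a\<^sup>2 + d\<^sup>2)"
  assumes r: "r < 1" "r + a > 0"
  shows "\<exists>X X' Y Y'. parabolic_lift a d (1 / r + a) (xi_quarter a d) (eta_quarter a d) X X' Y Y'"
proof -
  have ar: "\<bar>a\<bar> \<le> r" unfolding r_def by (rule real_sqrt_ge_abs1)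
  have r0: "r > 0" using ar r by linarith
  have r2: "r\<^sup>2 = a\<^sup>2 + d\<^sup>2" by (simp add: r_def)
  define A where "A = sqrt (r + a)"
  have A: "A > 0" "A\<^sup>2 = r + a" using r by (auto simp: A_def)
  \<comment> \<open>This choice gives \<open>B\<close> the sign of \<open>d\<close>. For
    \<open>d = 0\<close> the coordinate \<open>Y\<close> vanishes identically, which is the extra
    case in \<open>Y_zero\<close>.\<close>
  define B where "B = d / A"
  have "B\<^sup>2 = d\<^sup>2 / (r + a)" by (simp add: B_def power_divide A)
  also have "d\<^sup>2 = (r - a) * (r + a)" using r2 by (simp add: algebra_simps power2_eq_square)
  finally have B: "B\<^sup>2 = r - a" "A * B = d" using r A by (auto simp: B_def)
  define \<alpha> where "\<alpha> = 2 / r + a - r"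
  define \<beta> where "\<beta> = 2 / r + a + r"
  define c where "c = 1 / r + a"
  have inv: "2 / r > 2" using r0 r by (simp add: field_simps)
  have al: "\<alpha> > 0" "\<alpha> + - (r + a) > 0" "\<beta> > 0" "\<beta> + (r - a) > 0"
    unfolding \<alpha>_def \<beta>_def using inv r ar r0 by linarith+
  have ac: "\<alpha> + A\<^sup>2 = 2 * c" "\<beta> - B\<^sup>2 = 2 * c"
    by (auto simp: \<alpha>_def \<beta>_def A B c_def)
  \<comment> \<open>The sum of the two separated energies, which supplies the constant 4 in
    \<open>energy\<close>.\<close>
  have AB: "A\<^sup>2 * \<alpha> + B\<^sup>2 * \<beta> = 4"
    using r0 unfolding A B \<alpha>_def \<beta>_def by (simp add: field_simps)
  define K where "K = quarter_period \<alpha> (- (r + a))"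
  define L where "L = quarter_period \<beta> (r - a)"
  obtain z z' where K: "K > 0" and z0: "z 0 = 1" "z' 0 = 0"
    and z: "\<And>\<tau>. (z has_real_derivative z' \<tau>) (at \<tau>)"
    and z': "\<And>\<tau>. (z' has_real_derivative - (\<alpha> - - (r + a)) * z \<tau> - 2 * (- (r + a)) * z \<tau> ^ 3) (at \<tau>)"
    and ez: "\<And>\<tau>. (z' \<tau>)\<^sup>2 = (1 - (z \<tau>)\<^sup>2) * (\<alpha> + - (r + a) * (z \<tau>)\<^sup>2)"
    and zz: "\<And>\<tau>. z \<tau> = 0 \<longleftrightarrow> (\<exists>n::int. odd n \<and> \<tau> = of_int n * K)"
    and zp: "\<And>\<tau>. \<bar>\<tau>\<bar> < K \<Longrightarrow> z \<tau> > 0"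
    and zper: "\<And>\<tau>. z (\<tau> + 4 * K) = z \<tau>" "\<And>\<tau>. z' (\<tau> + 4 * K) = z' \<tau>"
    and "\<And>n::int. even n \<Longrightarrow> z' (of_int n * K) = 0"
    by (rule pendulum_oscillator[OF al(1,2), folded K_def]) (rule that)
  obtain w w' where L: "L > 0" and w0: "w 0 = 1" "w' 0 = 0"
    and w: "\<And>\<tau>. (w has_real_derivative w' \<tau>) (at \<tau>)"
    and w': "\<And>\<tau>. (w' has_real_derivative - (\<beta> - (r - a)) * w \<tau> - 2 * (r - a) * w \<tau> ^ 3) (at \<tau>)"
    and ew: "\<And>\<tau>. (w' \<tau>)\<^sup>2 = (1 - (w \<tau>)\<^sup>2) * (\<beta> + (r - a) * (w \<tau>)\<^sup>2)"
    and wz: "\<And>\<tau>. w \<tau> = 0 \<longleftrightarrow> (\<exists>n::int. odd n \<and> \<tau> = of_int n * L)"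
    and "\<And>\<tau>. \<bar>\<tau>\<bar> < L \<Longrightarrow> w \<tau> > 0"
    and wper: "\<And>\<tau>. w (\<tau> + 4 * L) = w \<tau>" "\<And>\<tau>. w' (\<tau> + 4 * L) = w' \<tau>"
    and weven: "\<And>n::int. even n \<Longrightarrow> w' (of_int n * L) = 0"
    by (rule pendulum_oscillator[OF al(3,4), folded L_def]) (rule that)
  have KL: "xi_quarter a d = K" "eta_quarter a d = L"
    by (auto simp: xi_quarter_def eta_quarter_def K_def L_def Let_def \<alpha>_def \<beta>_def r_def)
  have "parabolic_lift a d c K L (\<lambda>\<tau>. A * z \<tau>) (\<lambda>\<tau>. A * z' \<tau>) (\<lambda>\<tau>. B * w \<tau>) (\<lambda>\<tau>. B * w' \<tau>)"
  proof
    show "K > 0" "L > 0" by fact+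
    show "((A * z 0)\<^sup>2 - (B * w 0)\<^sup>2) / 2 = a" by (simp add: z0 w0 A B)
    show "A * z 0 * (B * w 0) = d" by (simp add: z0 w0 B)
    show "A * z' 0 = 0" "B * w' 0 = 0" by (simp_all add: z0 w0)
    fix \<tau>
    show "((\<lambda>\<tau>. A * z \<tau>) has_real_derivative A * z' \<tau>) (at \<tau>)" by (rule DERIV_cmult[OF z])
    show "((\<lambda>\<tau>. B * w \<tau>) has_real_derivative B * w' \<tau>) (at \<tau>)" by (rule DERIV_cmult[OF w])
    have "A * (- (\<alpha> - - (r + a)) * z \<tau> - 2 * (- (r + a)) * z \<tau> ^ 3) = 2 * (A * z \<tau>) ^ 3 - 2 * c * (A * z \<tau>)"
      unfolding A(2)[symmetric] ac(1)[symmetric]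
      by (simp add: algebra_simps power2_eq_square power3_eq_cube)
    then show "((\<lambda>\<tau>. A * z' \<tau>) has_real_derivative 2 * (A * z \<tau>) ^ 3 - 2 * c * (A * z \<tau>)) (at \<tau>)"
      using DERIV_cmult[OF z', of A \<tau>] by (simp only:)
    have "B * (- (\<beta> - (r - a)) * w \<tau> - 2 * (r - a) * w \<tau> ^ 3) = - 2 * (B * w \<tau>) ^ 3 - 2 * c * (B * w \<tau>)"
      unfolding B(1)[symmetric] ac(2)[symmetric]
      by (simp add: algebra_simps power2_eq_square power3_eq_cube)
    then show "((\<lambda>\<tau>. B * w' \<tau>) has_real_derivative - 2 * (B * w \<tau>) ^ 3 - 2 * c * (B * w \<tau>)) (at \<tau>)"
      using DERIV_cmult[OF w', of B \<tau>] by (simp only:)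
    have "(A * z' \<tau>)\<^sup>2 = A\<^sup>2 * \<alpha> + (A * z \<tau>) ^ 4 - 2 * c * (A * z \<tau>)\<^sup>2"
      unfolding power_mult_distrib ez A(2)[symmetric] ac(1)[symmetric]
      by (simp add: algebra_simps power2_eq_square power4_eq_xxxx)
    moreover have "(B * w' \<tau>)\<^sup>2 = B\<^sup>2 * \<beta> - (B * w \<tau>) ^ 4 - 2 * c * (B * w \<tau>)\<^sup>2"
      unfolding power_mult_distrib ew B(1)[symmetric] ac(2)[symmetric]
      by (simp add: algebra_simps power2_eq_square power4_eq_xxxx)
    ultimately show "(A * z' \<tau>)\<^sup>2 + (B * w' \<tau>)\<^sup>2
        = 4 + (A * z \<tau>) ^ 4 - (B * w \<tau>) ^ 4 - 2 * c * ((A * z \<tau>)\<^sup>2 + (B * w \<tau>)\<^sup>2)"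
      using AB by (simp add: algebra_simps)
    show "A * z \<tau> > 0" if "\<bar>\<tau>\<bar> < K" using zp[OF that] A by simp
    show "A * z \<tau> = 0 \<longleftrightarrow> (\<exists>n::int. odd n \<and> \<tau> = of_int n * K)" using A zz by simp
    show "B * w \<tau> = 0 \<longleftrightarrow> d = 0 \<or> (\<exists>n::int. odd n \<and> \<tau> = of_int n * L)" using A wz by (simp add: B_def)
    show "A * z (\<tau> + 4 * K) = A * z \<tau>" "A * z' (\<tau> + 4 * K) = A * z' \<tau>"
      "B * w (\<tau> + 4 * L) = B * w \<tau>" "B * w' (\<tau> + 4 * L) = B * w' \<tau>" by (simp_all add: zper wper)
    show "B * w' (of_int n * L) = 0" if "even n" for n :: int using weven[OF that] by simp
  qed
  then show ?thesis unfolding KL c_def by blast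
qed

section \<open>Asymptotics of the quarter periods\<close>

lemma continuous_on_quarter_period:
  assumes \<alpha>: "continuous_on U \<alpha>" and \<beta>: "continuous_on U \<beta>"
    and pos: "\<And>x. x \<in> U \<Longrightarrow> \<alpha> x > 0" "\<And>x. x \<in> U \<Longrightarrow> \<alpha> x + \<beta> x > 0"
  shows "continuous_on U (\<lambda>x::real. quarter_period (\<alpha> x) (\<beta> x))"
proof -
  have "continuous_on (U \<times> cbox 0 (pi/2)) (\<lambda>p. 1 / sqrt (\<alpha> (fst p) + \<beta> (fst p) * (cos (snd p))\<^sup>2))"
  proof (intro continuous_intros ballI)
    show "continuous_on (U \<times> cbox 0 (pi/2)) (\<lambda>p. \<alpha> (fst p))" "continuous_on (U \<times> cbox 0 (pi/2)) (\<lambda>p. \<beta> (fst p))"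
      by (rule continuous_on_compose2[OF \<alpha>] continuous_on_compose2[OF \<beta>]; auto intro: continuous_intros)+
    show "sqrt (\<alpha> (fst p) + \<beta> (fst p) * (cos (snd p))\<^sup>2) \<noteq> 0" if "p \<in> U \<times> cbox 0 (pi/2)" for p
    proof -
      have "fst p \<in> U" using that by auto
      from clock_radicand_pos[OF pos[OF this], of "snd p"] show ?thesis by simp
    qed
  qed
  then have "continuous_on (U \<times> cbox 0 (pi/2)) (\<lambda>(x, t). 1 / sqrt (\<alpha> x + \<beta> x * (cos t)\<^sup>2))"
    by (simp add: split_def)
  from integral_continuous_on_param[OF this] show ?thesis
    unfolding quarter_period_def by simp
qed

lemma has_integral_quarter_period:
  assumes "\<alpha> > 0" "\<alpha> + \<beta> > 0"
  shows "((\<lambda>s. 1 / sqrt (\<alpha> + \<beta> * (cos s)\<^sup>2)) has_integral quarter_period \<alpha> \<beta>) {0..pi/2}"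
proof -
  have nz: "sqrt (\<alpha> + \<beta> * (cos s)\<^sup>2) \<noteq> 0" for s
    using clock_radicand_pos[OF assms, of s] by simp
  have "continuous_on {0..pi/2} (\<lambda>s. 1 / sqrt (\<alpha> + \<beta> * (cos s)\<^sup>2))"
    using nz by (intro continuous_intros) auto
  then show ?thesis
    unfolding quarter_period_def by (intro integrable_integral integrable_continuous_interval)
qed

lemma radius_bounds:
  fixes a d :: real
  defines "r \<equiv> sqrt (a\<^sup>2 + d\<^sup>2)"
  assumes "r < 1" "r + a > 0"
  shows "r > 0" "\<bar>a\<bar> \<le> r" "2 / r > 2" "1 / r - r > 0"
    "2 / r + a - r > 0" "2 / r + a - r + - (r + a) > 0" "2 / r + a + r > 0" "2 / r + a + r + (r - a) > 0"
proof -
  show ar: "\<bar>a\<bar> \<le> r" unfolding r_def by (rule real_sqrt_ge_abs1)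
  show r0: "r > 0" using ar assms by linarith
  show r2: "2 / r > 2" using r0 assms by (simp add: field_simps)
  have "1 / r > 1" using r0 assms by (simp add: field_simps)
  then show "1 / r - r > 0" using assms by linarith
  show "2 / r + a - r > 0" "2 / r + a - r + - (r + a) > 0" "2 / r + a + r > 0" "2 / r + a + r + (r - a) > 0"
    using ar r0 r2 assms by linarith+
qed

text \<open>With \<open>e^2 = 1 / r - r\<close> the radicand is at most
  \<open>(2 * (e + s))^2\<close>, because the sine is bounded by its argument and
  \<open>r + a \<le> 2\<close>. Comparing integrals leaves the divergent term
  \<open>- ln e / 2\<close>, a quarter of \<open>- ln (1 / r - r)\<close>.\<close>

lemma xi_quarter_lower_bound:
  fixes a d :: real
  defines "r \<equiv> sqrt (a\<^sup>2 + d\<^sup>2)"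
  assumes r: "r < 1" "r + a > 0"
  shows "- ln (1 / r - r) / 4 \<le> xi_quarter a d"
proof -
  note b = radius_bounds[OF r[unfolded r_def], folded r_def]
  define e where "e = sqrt (1 / r - r)"
  have e: "e > 0" "e\<^sup>2 = 1 / r - r" using b(4) by (auto simp: e_def)
  have "((\<lambda>s. 1 / (2 * (e + s))) has_integral (ln (e + pi/2) / 2 - ln (e + 0) / 2)) {0..pi/2}"
  proof (rule fundamental_theorem_of_calculus)
    show "((\<lambda>s. ln (e + s) / 2) has_vector_derivative 1 / (2 * (e + s))) (at s within {0..pi/2})"
      if "s \<in> {0..pi/2}" for s
      using that e unfolding has_real_derivative_iff_has_vector_derivative[symmetric]
      by (auto intro!: derivative_eq_intros simp: divide_simps)
  qed simp
  moreover have "1 / (2 * (e + s)) \<le> 1 / sqrt (2 / r + a - r + - (r + a) * (cos s)\<^sup>2)"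
    if s: "s \<in> {0..pi/2}" for s
  proof -
    have pos: "2 / r + a - r + - (r + a) * (cos s)\<^sup>2 > 0"
      using clock_radicand_pos[OF b(5,6)] .
    have "\<bar>sin s\<bar> \<le> \<bar>s\<bar>" by (rule abs_sin_x_le_abs_x)
    then have sin: "(sin s)\<^sup>2 \<le> s\<^sup>2" by (simp add: abs_le_square_iff)
    have "2 / r + a - r + - (r + a) * (cos s)\<^sup>2 = 2 * (1 / r - r) + (r + a) * (sin s)\<^sup>2"
      by (simp add: cos_squared_eq algebra_simps)
    also have "\<dots> \<le> 2 * (1 / r - r) + 2 * s\<^sup>2"
      using sin r b(2) by (intro add_mono mult_mono order_refl) auto
    also have "\<dots> = 2 * e\<^sup>2 + 2 * s\<^sup>2" by (simp add: e)
    also have "\<dots> \<le> (2 * (e + s))\<^sup>2"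
      using e s mult_nonneg_nonneg[of e s] by (simp add: power2_eq_square algebra_simps)
    finally have "sqrt (2 / r + a - r + - (r + a) * (cos s)\<^sup>2) \<le> 2 * (e + s)"
      using e s by (intro real_le_lsqrt) auto
    then show ?thesis using pos by (intro divide_left_mono mult_pos_pos) (use e s in auto)
  qed
  ultimately have "ln (e + pi/2) / 2 - ln (e + 0) / 2 \<le> quarter_period (2 / r + a - r) (- (r + a))"
    using has_integral_quarter_period[OF b(5,6)] has_integral_le by blast
  moreover have "ln (e + pi/2) \<ge> 0" using e pi_ge_two by (intro ln_ge_zero) linarith
  moreover have "ln (1 / r - r) = 2 * ln e" using e by (simp flip: e(2) add: ln_realpow)
  ultimately show ?thesis by (simp add: xi_quarter_def Let_def r_def)
qed

text \<open>The radicand is at least 1, so the integral is at most \<open>pi / 2\<close>, which is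
  rounded up to 2.\<close>

lemma eta_quarter_upper_bound:
  fixes a d :: real
  defines "r \<equiv> sqrt (a\<^sup>2 + d\<^sup>2)"
  assumes r: "r < 1" "r + a > 0"
  shows "eta_quarter a d \<le> 2"
proof -
  note b = radius_bounds[OF r[unfolded r_def], folded r_def]
  have "1 / sqrt (2 / r + a + r + (r - a) * (cos s)\<^sup>2) \<le> 1" for s
  proof -
    have "(r - a) * (cos s)\<^sup>2 \<ge> 0" using b(2) by (intro mult_nonneg_nonneg) auto
    then have "1 \<le> 2 / r + a + r + (r - a) * (cos s)\<^sup>2" using b r by linarith
    then show ?thesis by simp
  qed
  moreover have "((\<lambda>s. 1) has_integral (pi/2)) {0..pi/2}"
    using has_integral_const_real[of "1::real" 0 "pi/2"] by simp
  ultimately have "quarter_period (2 / r + a + r) (r - a) \<le> pi/2"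
    using has_integral_quarter_period[OF b(7,8)] has_integral_le by blast
  then show ?thesis using pi_less_4 by (simp add: eta_quarter_def Let_def r_def)
qed

text \<open>The 8 combines the 4 and the 2 of the two preceding bounds. The hypothesis
  \<open>small\<close> makes \<open>- ln (1 / r - r)\<close> nonnegative, as replacing the
  denominator by its upper bound requires.\<close>

lemma quarter_ratio_lower_bound:
  fixes a d :: real
  defines "r \<equiv> sqrt (a\<^sup>2 + d\<^sup>2)"
  assumes r: "r < 1" "r + a > 0" and small: "1 / r - r \<le> 1"
  shows "- ln (1 / r - r) / 8 \<le> xi_quarter a d / eta_quarter a d"
proof -
  note b = radius_bounds[OF r[unfolded r_def], folded r_def]
  have L: "eta_quarter a d > 0"
    using parabolic_lift_exists[OF r[unfolded r_def]] parabolic_lift.L by blast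
  have "- ln (1 / r - r) / 8 = (- ln (1 / r - r) / 4) / 2" by simp
  also have "\<dots> \<le> (- ln (1 / r - r) / 4) / eta_quarter a d"
    using L eta_quarter_upper_bound[OF r[unfolded r_def]] b(4) small
    by (intro divide_left_mono) auto
  also have "\<dots> \<le> xi_quarter a d / eta_quarter a d"
    using xi_quarter_lower_bound[OF r[unfolded r_def]] L by (intro divide_right_mono) (auto simp: r_def)
  finally show ?thesis .
qed

section \<open>Level sets of the period ratio\<close>

lemma last_level_point:
  fixes \<rho> :: "real \<Rightarrow> real"
  assumes mD: "m < D" and cont: "continuous_on {m..<D} \<rho>"
    and lim: "filterlim \<rho> at_top (at_left D)" and l: "\<rho> m \<le> l"
  obtains z where "m \<le> z" "z < D" "\<rho> z = l" "\<And>w. z < w \<Longrightarrow> w < D \<Longrightarrow> \<rho> w > l"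
proof -
  have "eventually (\<lambda>y. \<rho> y > l) (at_left D)" using lim unfolding filterlim_at_top_dense by blast
  then obtain b where b: "b < D" "\<And>y. b < y \<Longrightarrow> y < D \<Longrightarrow> \<rho> y > l"
    using iffD1[OF eventually_at_left[OF mD]] by blast
  \<comment> \<open>Beyond \<open>q\<close> everything already lies above the level, so the search
    is confined to the compact interval \<open>{m..q}\<close>.\<close>
  define q where "q = (max b m + D) / 2"
  have q: "m < q" "b < q" "q < D" using b mD by (auto simp: q_def)
  have cq: "continuous_on {m..q} \<rho>" by (rule continuous_on_subset[OF cont]) (use q in auto)
  define S where "S = {z \<in> {m..q}. \<rho> z \<le> l}"
  have "closed S"
    unfolding S_def by (intro continuous_on_closed_Collect_le cq continuous_intros closed_atLeastAtMost)
  moreover have "bounded S"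
    by (rule bounded_subset[OF compact_imp_bounded[OF compact_Icc[of m q]]]) (auto simp: S_def)
  ultimately have "compact S" by (simp add: compact_eq_bounded_closed)
  moreover have "m \<in> S" using l q by (simp add: S_def)
  ultimately obtain z where z: "z \<in> S" "\<And>w. w \<in> S \<Longrightarrow> w \<le> z"
    using compact_attains_sup[of S] by blast
  have zq: "m \<le> z" "z \<le> q" "\<rho> z \<le> l" using z(1) by (auto simp: S_def)
  have "\<rho> q > l" using b q by blast
  have above: "\<rho> w > l" if "z < w" "w < D" for w
  proof (cases "w \<le> q")
    case True
    moreover have "w \<notin> S" using z(2)[of w] that(1) by auto
    ultimately show ?thesis using that zq by (simp add: S_def)
  next
    case False
    then show ?thesis using b(2)[of w] q that by auto
  qed
  have "\<exists>w\<ge>z. w \<le> q \<and> \<rho> w = l"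
  proof (rule IVT')
    show "continuous_on {z..q} \<rho>" by (rule continuous_on_subset[OF cq]) (use zq in auto)
  qed (use zq \<open>\<rho> q > l\<close> in auto)
  then obtain w where w: "z \<le> w" "w \<le> q" "\<rho> w = l" by blast
  have "\<not> z < w"
  proof
    assume "z < w"
    then have "\<rho> w > l" using above w(2) q by simp
    then show False using w(3) by simp
  qed
  then have "w = z" using w by simp
  with w zq q show thesis by (intro that[OF zq(1) _ _ above]) auto
qed

text \<open>If the last point of level \<open>n + 1\<close> came before that of level
  \<open>n\<close>, the latter would have a value above \<open>n + 1\<close>. Convergence to
  \<open>D\<close> holds because \<open>\<rho>\<close> is bounded on each compact part of
  \<open>{m..<D}\<close>, so high levels must lie to its right.\<close>

lemma level_sequence:
  fixes \<rho> :: "real \<Rightarrow> real"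
  assumes mD: "m < D" and cont: "continuous_on {m..<D} \<rho>" and lim: "filterlim \<rho> at_top (at_left D)"
  obtains S n0 where "\<And>n. n \<ge> n0 \<Longrightarrow> m \<le> S n \<and> S n < D \<and> \<rho> (S n) = real n \<and> S n < S (Suc n)"
    "S \<longlonglongrightarrow> D"
proof -
  \<comment> \<open>From this index on the levels are at least \<open>\<rho> m\<close>, as
    \<open>last_level_point\<close> requires.\<close>
  define n0 where "n0 = nat \<lceil>\<rho> m\<rceil>"
  have n0: "\<rho> m \<le> real n" if "n \<ge> n0" for n using that unfolding n0_def by linarith
  define P where "P = (\<lambda>n z. m \<le> z \<and> z < D \<and> \<rho> z = real n \<and> (\<forall>w. z < w \<longrightarrow> w < D \<longrightarrow> \<rho> w > real n))"
  define S where "S = (\<lambda>n. SOME z. P n z)"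
  have PS: "P n (S n)" if n: "n \<ge> n0" for n
  proof -
    obtain z where "m \<le> z" "z < D" "\<rho> z = real n" "\<And>w. z < w \<Longrightarrow> w < D \<Longrightarrow> \<rho> w > real n"
      by (rule last_level_point[OF mD cont lim n0[OF n]]) (rule that)
    then have "P n z" by (simp add: P_def)
    then show ?thesis unfolding S_def by (rule someI)
  qed
  have S: "m \<le> S n" "S n < D" "\<rho> (S n) = real n" "\<And>w. S n < w \<Longrightarrow> w < D \<Longrightarrow> \<rho> w > real n"
    if "n \<ge> n0" for n
    using PS[OF that] by (simp_all add: P_def)
  have incr: "S n < S (Suc n)" if n: "n \<ge> n0" for n
  proof (rule ccontr)
    have n': "Suc n \<ge> n0" using n by simp
    assume "\<not> S n < S (Suc n)"
    then consider "S (Suc n) = S n" | "S (Suc n) < S n" by linarith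
    then show False
    proof cases
      case 1
      then show ?thesis using S(3)[OF n] S(3)[OF n'] by simp
    next
      case 2
      then have "\<rho> (S n) > real (Suc n)" using S(4)[OF n'] S(2)[OF n] by blast
      then show ?thesis using S(3)[OF n] by simp
    qed
  qed
  have "S \<longlonglongrightarrow> D"
  proof (rule order_tendstoI)
    fix e assume "e < D"
    define q where "q = max m e"
    have q: "m \<le> q" "e \<le> q" "q < D" using \<open>e < D\<close> mD by (auto simp: q_def)
    have "continuous_on {m..q} \<rho>" by (rule continuous_on_subset[OF cont]) (use q in auto)
    moreover have "{m..q} \<noteq> {}" using q by simp
    ultimately obtain M where M: "\<And>w. w \<in> {m..q} \<Longrightarrow> \<rho> w \<le> \<rho> M"
      using continuous_attains_sup[OF compact_Icc] by blast
    have "e < S n" if n: "n \<ge> max n0 (Suc (nat \<lceil>\<rho> M\<rceil>))" for n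
    proof (rule ccontr)
      assume "\<not> e < S n"
      moreover have n': "n \<ge> n0" "n \<ge> Suc (nat \<lceil>\<rho> M\<rceil>)" using n by auto
      ultimately have "real n \<le> \<rho> M" using S(1,3)[OF n'(1)] M[of "S n"] q by simp
      then show False using n'(2) by linarith
    qed
    then show "eventually (\<lambda>n. e < S n) sequentially" using eventually_sequentially by blast
  next
    fix e assume "D < e"
    then show "eventually (\<lambda>n. S n < e) sequentially"
      using S(2) by (intro eventually_sequentiallyI[of n0]) (meson less_trans)
  qed
  then show thesis using that[of n0 S] S(1-3) incr by blast
qed

section \<open>Existence of the orbit families and growth of their least starting index\<close>

lemma brake_orbit_radius_less_one:
  assumes "brake_orbit_k a d k" "a > 0"
  shows "sqrt (a\<^sup>2 + d\<^sup>2) < 1"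
proof (rule ccontr)
  assume r: "\<not> ?thesis"
  obtain x y u v T where sol: "stark_sol x y u v UNIV"
    and i: "x 0 = a" "y 0 = d" "u 0 = 0" "v 0 = 0" and T: "T > 0" "y T = 0" "x T < 0"
    using assms(1) unfolding brake_orbit_k_def by blast
  have "stark_sol x y u v {0..T}" using sol by (rule stark_sol_subset) simp
  \<comment> \<open>On the negative axis \<open>r + x\<close> vanishes, whereas the barrier keeps it
    at or above its initial value, which is positive for \<open>a > 0\<close>.\<close>
  from stark_brake_parabolic_barrier[OF this] have "sqrt (a\<^sup>2 + d\<^sup>2) + a \<le> 0"
    using i T r by simp
  moreover have "sqrt (a\<^sup>2 + d\<^sup>2) \<ge> 0" by simp
  ultimately show False using \<open>a > 0\<close> by linarith
qed

lemma stark_family_exists: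
  assumes a: "a \<in> {-1<..<1::real}"
  shows "\<exists>kb d d'. stark_family a kb d d'"
proof -
  define D where "D = sqrt (1 - a\<^sup>2)"
  define r where "r = (\<lambda>d. sqrt (a\<^sup>2 + d\<^sup>2))"
  define \<rho> where "\<rho> = (\<lambda>d. xi_quarter a d / eta_quarter a d)"
  have "a\<^sup>2 < 1" using a by (auto simp: abs_square_less_1)
  then have D: "D > 0" "D\<^sup>2 = 1 - a\<^sup>2" by (auto simp: D_def)
  have rd: "r d < 1" "r d + a > 0" if "0 < d" "d < D" for d
  proof -
    have "d\<^sup>2 < D\<^sup>2" using that by (intro power_strict_mono) auto
    then show "r d < 1" using D by (simp add: r_def)
    have "sqrt (a\<^sup>2) < r d" using that unfolding r_def by (intro real_sqrt_less_mono) simp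
    then show "r d + a > 0" by simp
  qed
  have bounds: "r d > 0" "1 / r d - r d > 0"
    "2 / r d + a - r d > 0" "2 / r d + a - r d + - (r d + a) > 0"
    "2 / r d + a + r d > 0" "2 / r d + a + r d + (r d - a) > 0" if "0 < d" "d < D" for d
    unfolding r_def by (rule radius_bounds[OF rd[OF that, unfolded r_def]])+
  have cr: "continuous_on U r" for U unfolding r_def by (intro continuous_intros)
  \<comment> \<open>The left end \<open>D/2\<close> keeps \<open>d\<close> positive, so that
    \<open>r d\<close> exceeds the modulus of \<open>a\<close> and the parabolic lift exists for
    negative \<open>a\<close> too.\<close>
  have cont: "continuous_on {D/2..<D} \<rho>"
  proof -
    have pos: "0 < d" "d < D" if "d \<in> {D/2..<D}" for d using that D by auto
    have nz: "r d \<noteq> 0" if "d \<in> {D/2..<D}" for d using bounds(1)[OF pos[OF that]] by simp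
    have "continuous_on {D/2..<D} (\<lambda>d. quarter_period (2 / r d + a - r d) (- (r d + a)))"
    proof (rule continuous_on_quarter_period)
      show "continuous_on {D/2..<D} (\<lambda>d. 2 / r d + a - r d)" "continuous_on {D/2..<D} (\<lambda>d. - (r d + a))"
        using nz by (intro continuous_intros cr ballI; simp)+
      show "2 / r d + a - r d > 0" "2 / r d + a - r d + (- (r d + a)) > 0" if "d \<in> {D/2..<D}" for d
        using bounds(3,4)[OF pos[OF that]] by simp_all
    qed
    then have 1: "continuous_on {D/2..<D} (xi_quarter a)"
      by (simp add: xi_quarter_def[abs_def] Let_def r_def)
    have "continuous_on {D/2..<D} (\<lambda>d. quarter_period (2 / r d + a + r d) (r d - a))"
    proof (rule continuous_on_quarter_period)
      show "continuous_on {D/2..<D} (\<lambda>d. 2 / r d + a + r d)" "continuous_on {D/2..<D} (\<lambda>d. r d - a)"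
        using nz by (intro continuous_intros cr ballI; simp)+
      show "2 / r d + a + r d > 0" "2 / r d + a + r d + (r d - a) > 0" if "d \<in> {D/2..<D}" for d
        using bounds(5,6)[OF pos[OF that]] by simp_all
    qed
    then have 2: "continuous_on {D/2..<D} (eta_quarter a)"
      by (simp add: eta_quarter_def[abs_def] Let_def r_def)
    have "eta_quarter a d > 0" if "d \<in> {D/2..<D}" for d
      using parabolic_lift_exists[OF rd[OF pos[OF that], unfolded r_def]] parabolic_lift.L by blast
    then have "\<forall>d\<in>{D/2..<D}. eta_quarter a d \<noteq> 0" by (simp add: less_imp_neq[symmetric])
    then show ?thesis unfolding \<rho>_def using 1 2 by (intro continuous_on_divide)
  qed
  have ev: "eventually (\<lambda>d. 0 < d \<and> d < D) (at_left D)"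
    using eventually_at_left_real[OF D(1)] by (simp add: greaterThanLessThan_iff)
  have tend: "((\<lambda>d. 1 / r d - r d) \<longlongrightarrow> 0) (at_left D)"
  proof -
    have "r D = 1" using D by (simp add: r_def)
    have "isCont (\<lambda>d. 1 / r d - r d) D"
      using \<open>r D = 1\<close> unfolding r_def by (intro continuous_intros) auto
    then have "((\<lambda>d. 1 / r d - r d) \<longlongrightarrow> 1 / r D - r D) (at_left D)"
      unfolding isCont_def by (rule tendsto_mono[OF at_le[OF subset_UNIV]])
    then show ?thesis by (simp add: \<open>r D = 1\<close>)
  qed
  \<comment> \<open>Near \<open>D\<close> the quantity \<open>1 / r d - r d\<close> tends to 0 from
    above, so the logarithmic lower bound drives the ratio to infinity.\<close>
  have lim: "filterlim \<rho> at_top (at_left D)"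
  proof (rule filterlim_at_top_mono)
    have "filterlim (\<lambda>d. 1 / r d - r d) (at_right 0) (at_left D)"
      by (rule tendsto_imp_filterlim_at_right[OF tend])
        (rule eventually_mono[OF ev], use bounds(2) in auto)
    then have "filterlim (\<lambda>d. ln (1 / r d - r d)) at_bot (at_left D)"
      by (rule filterlim_compose[OF ln_at_0])
    then have "filterlim (\<lambda>d. - ln (1 / r d - r d)) at_top (at_left D)"
      by (simp add: filterlim_uminus_at_top)
    then have "filterlim (\<lambda>d. (1/8) * - ln (1 / r d - r d)) at_top (at_left D)"
      by (intro filterlim_tendsto_pos_mult_at_top[OF tendsto_const]) simp_all
    then show "filterlim (\<lambda>d. - ln (1 / r d - r d) / 8) at_top (at_left D)" by simp
    have "eventually (\<lambda>d. 1 / r d - r d < 1) (at_left D)"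
      using order_tendstoD(2)[OF tend] by simp
    with ev show "eventually (\<lambda>d. - ln (1 / r d - r d) / 8 \<le> \<rho> d) (at_left D)"
    proof eventually_elim
      case (elim d)
      then show ?case
        unfolding \<rho>_def r_def using quarter_ratio_lower_bound[of a d] rd[of d] by (simp add: r_def)
    qed
  qed
  have D2: "D/2 < D" using D by simp
  obtain S n0 where S: "\<And>n. n \<ge> n0 \<Longrightarrow> D/2 \<le> S n \<and> S n < D \<and> \<rho> (S n) = real n \<and> S n < S (Suc n)"
    and lim: "S \<longlonglongrightarrow> D"
    by (rule level_sequence[OF D2 cont lim]) (rule that)
  have orbit: "brake_orbit_k a (S n) k" if "n \<ge> n0" "n = 2 * k" for n k
  proof -
    have d: "0 < S n" "S n < D" using S[OF that(1)] D by auto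
    obtain X X' Y Y' where "parabolic_lift a (S n) (1 / r (S n) + a) (xi_quarter a (S n)) (eta_quarter a (S n)) X X' Y Y'"
      using parabolic_lift_exists[OF rd[OF d, unfolded r_def]] unfolding r_def by blast
    then interpret parabolic_lift a "S n" "1 / r (S n) + a" "xi_quarter a (S n)" "eta_quarter a (S n)" X X' Y Y' .
    have "xi_quarter a (S n) = real n * eta_quarter a (S n)"
      using S[OF that(1)] L by (simp add: \<rho>_def field_simps)
    then show ?thesis using brake_orbit_lift[of k] d that(2) by simp
  qed
  have orbit': "collision_orbit_k a (S n) k" if "n \<ge> n0" "n = 2 * k + 1" for n k
  proof -
    have d: "0 < S n" "S n < D" using S[OF that(1)] D by auto
    obtain X X' Y Y' where "parabolic_lift a (S n) (1 / r (S n) + a) (xi_quarter a (S n)) (eta_quarter a (S n)) X X' Y Y'"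
      using parabolic_lift_exists[OF rd[OF d, unfolded r_def]] unfolding r_def by blast
    then interpret parabolic_lift a "S n" "1 / r (S n) + a" "xi_quarter a (S n)" "eta_quarter a (S n)" X X' Y Y' .
    have "xi_quarter a (S n) = real n * eta_quarter a (S n)"
      using S[OF that(1)] L by (simp add: \<rho>_def field_simps)
    then show ?thesis using collision_orbit_lift[of k] d that(2) by (simp add: add.commute)
  qed
  have sub: "strict_mono (\<lambda>k::nat. 2 * k)" "strict_mono (\<lambda>k::nat. 2 * k + 1)"
    by (auto simp: strict_mono_def)
  \<comment> \<open>Even levels of the ratio give brake orbits and odd ones collision orbits, so
    monotonicity of \<open>S\<close> interleaves them. The index \<open>n0\<close> can serve as
    start because \<open>2 * k \<ge> k \<ge> n0\<close>.\<close>
  have "stark_family a n0 (\<lambda>k. S (2 * k)) (\<lambda>k. S (2 * k + 1))"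
    unfolding stark_family_def
  proof (intro conjI allI impI)
    fix k assume k: "n0 \<le> k"
    show "brake_orbit_k a (S (2 * k)) k" "collision_orbit_k a (S (2 * k + 1)) k"
      using k by (auto intro: orbit orbit')
    show "S (2 * k) < S (2 * k + 1)" "S (2 * k + 1) < S (2 * Suc k)"
      using S[of "2 * k"] S[of "2 * k + 1"] k by auto
  next
    show "(\<lambda>k. S (2 * k)) \<longlonglongrightarrow> sqrt (1 - a\<^sup>2)" "(\<lambda>k. S (2 * k + 1)) \<longlonglongrightarrow> sqrt (1 - a\<^sup>2)"
      using LIMSEQ_subseq_LIMSEQ[OF lim sub(1)] LIMSEQ_subseq_LIMSEQ[OF lim sub(2)]
      by (auto simp: o_def D_def)
  qed
  then show ?thesis by blast
qed

text \<open>A brake orbit with \<open>a > 0\<close> has \<open>r < 1\<close>, and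
  \<open>r \<ge> a\<close> then bounds \<open>1 / r - r\<close> independently of \<open>d\<close>.
  The exponent is chosen so that the lower bound on the period ratio exceeds
  \<open>2 * k + 1\<close>, which forces more than \<open>k\<close> crossings.\<close>

lemma no_brake_orbit_near_one:
  assumes a: "0 < a" "a < 1" and close: "1 / a - a < exp (- 8 * (2 * real k + 1))"
  shows "\<not> brake_orbit_k a d k"
proof
  assume orb: "brake_orbit_k a d k"
  define r where "r = sqrt (a\<^sup>2 + d\<^sup>2)"
  have r: "r < 1" "r + a > 0"
    using brake_orbit_radius_less_one[OF orb a(1)] a by (auto simp: r_def intro: add_nonneg_pos)
  note b = radius_bounds[OF r[unfolded r_def], folded r_def]
  have "1 / r \<le> 1 / a" using a b by (intro divide_left_mono) auto
  then have e: "1 / r - r < exp (- 8 * (2 * real k + 1))" using close a b by linarith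
  then have "ln (1 / r - r) < - 8 * (2 * real k + 1)"
    using ln_less_cancel_iff[OF b(4) exp_gt_zero] by simp
  moreover have "1 / r - r \<le> 1" using e by (smt (verit) exp_le_one_iff of_nat_0_le_iff)
  then have "- ln (1 / r - r) / 8 \<le> xi_quarter a d / eta_quarter a d"
    using quarter_ratio_lower_bound[OF r[unfolded r_def]] by (simp add: r_def)
  moreover have "2 * real k + 1 < - ln (1 / r - r) / 8" using calculation(1) by simp
  ultimately have ratio: "2 * real k + 1 < xi_quarter a d / eta_quarter a d" by (meson less_le_trans)
  obtain X X' Y Y' where "parabolic_lift a d (1 / r + a) (xi_quarter a d) (eta_quarter a d) X X' Y Y'"
    using parabolic_lift_exists[OF r[unfolded r_def]] unfolding r_def by blast
  then interpret parabolic_lift a d "1 / r + a" "xi_quarter a d" "eta_quarter a d" X X' Y Y' .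
  show False
    using many_crossings_not_brake_orbit[of k] orb ratio L by (simp add: pos_less_divide_eq)
qed

theorem theorem1p4:
  shows "(\<forall>a \<in> {-1<..<1::real}. \<exists>kb d d'. stark_family a kb d d') \<and>
         filterlim kb_min at_top (at_left (1::real))"
proof (intro conjI ballI stark_family_exists)
  show "filterlim kb_min at_top (at_left (1::real))"
    unfolding filterlim_at_top
  proof
    fix Z :: nat
    have "((\<lambda>a::real. 1 / a - a) \<longlongrightarrow> 1 / 1 - 1) (at_left 1)"
      by (intro tendsto_intros) auto
    then have "eventually (\<lambda>a::real. 1 / a - a < exp (- 8 * (2 * real Z + 1))) (at_left 1)"
      by (rule order_tendstoD(2)) simp
    moreover have "eventually (\<lambda>a::real. a \<in> {0<..<1}) (at_left 1)"
      by (rule eventually_at_left_real) simp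
    ultimately show "eventually (\<lambda>a. Z \<le> kb_min a) (at_left 1)"
    proof eventually_elim
      case (elim a)
      then have "\<exists>kb d d'. stark_family a kb d d'" by (intro stark_family_exists) auto
      then have "\<exists>d d'. stark_family a (kb_min a) d d'"
        unfolding kb_min_def by (rule LeastI_ex)
      then obtain d d' where "stark_family a (kb_min a) d d'" by blast
      \<comment> \<open>Were the least index at most \<open>Z\<close>, the family would contain a
        brake orbit with exactly \<open>Z\<close> crossings, which is excluded for \<open>a\<close>
        this close to 1.\<close>
      then have "brake_orbit_k a (d Z) Z" if "kb_min a \<le> Z" using that by (simp add: stark_family_def)
      with no_brake_orbit_near_one[of a Z "d Z"] elim show ?case by fastforce
    qed
  qed
qed

end
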